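(* The following decision problem is solvable in polynomial time: given a finite simple undirected graph $G$ with $\delta(G)=2$, determine whether $\gamma_t(G)=2\mu^*(G)$.
   Context: $\delta(G)$ is the minimum degree of $G$. A set $S\subseteq V(G)$ is a total dominating set of $G$ if every vertex of $V(G)$ (including those in $S$) is adjacent to a member of $S$; $\gamma_t(G)$ is the minimum cardinality of a total dominating set (defined when $G$ has no isolated vertices). A matching is a set of pairwise disjoint edges; a maximal matching is a matching not contained in a larger matching; $\mu^*(G)$ is the minimum cardinality of a maximal matching of $G$. Polynomial time means polynomial in the size of $G$ (number of vertices). *)

theory Defs
  imports Main "HOL-Computational_Algebra.Polynomial"
begin

section \<open>Finite simple graphs\<close>

text \<open>
  A graph is given by its vertex set \<open>V\<close> and its set \<open>E\<close> of edges, an edge being the two-element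
  set of its ends; this excludes loops and multiple edges. Graphs have at least one vertex.
\<close>

definition simple_graph :: "'a set \<Rightarrow> 'a set set \<Rightarrow> bool" where
  "simple_graph V E \<longleftrightarrow> finite V \<and> V \<noteq> {} \<and> (\<forall>e\<in>E. e \<subseteq> V \<and> card e = 2)"

definition vertex_degree :: "'a set set \<Rightarrow> 'a \<Rightarrow> nat" where
  "vertex_degree E v = card {e \<in> E. v \<in> e}"

definition min_degree :: "'a set \<Rightarrow> 'a set set \<Rightarrow> nat" where
  "min_degree V E = Min (vertex_degree E ` V)"

definition total_dominating_set :: "'a set \<Rightarrow> 'a set set \<Rightarrow> 'a set \<Rightarrow> bool" where
  "total_dominating_set V E S \<longleftrightarrow> S \<subseteq> V \<and> (\<forall>v\<in>V. \<exists>u\<in>S. {u, v} \<in> E)"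

text \<open>As usual, the following number is only meaningful for graphs without isolated vertices.\<close>

definition total_domination_number :: "'a set \<Rightarrow> 'a set set \<Rightarrow> nat" where
  "total_domination_number V E = Min {card S | S. total_dominating_set V E S}"

definition matching :: "'a set set \<Rightarrow> 'a set set \<Rightarrow> bool" where
  "matching E M \<longleftrightarrow> M \<subseteq> E \<and> pairwise disjnt M"

definition maximal_matching :: "'a set set \<Rightarrow> 'a set set \<Rightarrow> bool" where
  "maximal_matching E M \<longleftrightarrow> matching E M \<and> \<not> (\<exists>N. matching E N \<and> M \<subset> N)"

definition min_maximal_matching_number :: "'a set set \<Rightarrow> nat" where
  "min_maximal_matching_number E = Min {card M | M. maximal_matching E M}"

section \<open>Random access machines\<close>

text \<open>
  Polynomial time is measured on a random access machine with unit cost: a machine with registers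
  and a memory, both indexed by and containing natural numbers, and indirect addressing. The only
  arithmetic operations are addition and (truncated) subtraction. There is deliberately no
  multiplication: a number occurring within \<open>t\<close> steps has \<open>O(t)\<close> more bits than the input and
  program constants, so such machines and Turing machines simulate each other with polynomial
  overhead (Cook and Reckhow, 1973). Control flow is structured instead of given by jumps, which
  changes running times by a constant factor only.
\<close>

type_synonym ram_state = "(nat \<Rightarrow> nat) \<times> (nat \<Rightarrow> nat)"

datatype ram_program =
    Const nat nat
  | Add nat nat nat
  | Sub nat nat nat
  | Load nat nat
  | Store nat nat
  | Seq ram_program ram_program
  | IfNZ nat ram_program ram_program
  | WhileNZ nat ram_program

text \<open>
  \<open>exec c s t s'\<close>: started in state \<open>s\<close>, the program \<open>c\<close> halts after exactly \<open>t\<close> steps in state \<open>s'\<close>.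
  Each operation and each evaluation of a branching condition is one step.
\<close>

inductive exec :: "ram_program \<Rightarrow> ram_state \<Rightarrow> nat \<Rightarrow> ram_state \<Rightarrow> bool" where
  Const: "exec (Const i k) (r, m) 1 (r(i := k), m)"
| Add: "exec (Add i j k) (r, m) 1 (r(i := r j + r k), m)"
| Sub: "exec (Sub i j k) (r, m) 1 (r(i := r j - r k), m)"
| Load: "exec (Load i j) (r, m) 1 (r(i := m (r j)), m)"
| Store: "exec (Store i j) (r, m) 1 (r, m(r i := r j))"
| Seq: "exec c s t s' \<Longrightarrow> exec d s' u s'' \<Longrightarrow> exec (Seq c d) s (t + u) s''"
| IfTrue: "r i \<noteq> 0 \<Longrightarrow> exec c (r, m) t s' \<Longrightarrow> exec (IfNZ i c d) (r, m) (1 + t) s'"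
| IfFalse: "r i = 0 \<Longrightarrow> exec d (r, m) t s' \<Longrightarrow> exec (IfNZ i c d) (r, m) (1 + t) s'"
| WhileFalse: "r i = 0 \<Longrightarrow> exec (WhileNZ i c) (r, m) 1 (r, m)"
| WhileTrue: "r i \<noteq> 0 \<Longrightarrow> exec c (r, m) t s' \<Longrightarrow> exec (WhileNZ i c) s' u s''
    \<Longrightarrow> exec (WhileNZ i c) (r, m) (1 + t + u) s''"

inductive_cases exec_SeqE: "exec (Seq c d) s t s'"
inductive_cases exec_IfE: "exec (IfNZ i c d) (r, m) t s'"
inductive_cases exec_WhileE: "exec (WhileNZ i c) (r, m) t s'"

lemma exec_deterministic:
  "exec c s t s' \<Longrightarrow> exec c s u s'' \<Longrightarrow> t = u \<and> s' = s''"
proof (induction arbitrary: u s'' rule: exec.induct)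
  case (Seq c s t s' d v s0)
  from Seq.prems show ?case
    by (rule exec_SeqE) (metis Seq.IH)
next
  case (IfTrue r i c m t s' d)
  from IfTrue.prems show ?case
    by (rule exec_IfE) (use IfTrue.hyps(1) in \<open>auto dest: IfTrue.IH\<close>)
next
  case (IfFalse r i d m t s' c)
  from IfFalse.prems show ?case
    by (rule exec_IfE) (use IfFalse.hyps(1) in \<open>auto dest: IfFalse.IH\<close>)
next
  case (WhileFalse r i c m)
  from WhileFalse.prems show ?case
    by (rule exec_WhileE) (simp_all add: WhileFalse.hyps)
next
  case (WhileTrue r i c m t s' v s0)
  from WhileTrue.prems obtain t1 s1 u1
    where "u = 1 + t1 + u1" "exec c (r, m) t1 s1" "exec (WhileNZ i c) s1 u1 s''"
    by (rule exec_WhileE) (use WhileTrue.hyps(1) in auto)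
  then show ?case
    using WhileTrue.IH by blast
qed (erule exec.cases; simp)+

section \<open>Decision problems on graphs\<close>

text \<open>
  A graph on the vertices \<open>0, \<dots>, n - 1\<close> is input as its adjacency matrix, stored row by row in the
  memory cells \<open>0, \<dots>, n * n - 1\<close>, with \<open>n\<close> in register 0; everything else is 0.
\<close>

definition graph_input :: "nat \<Rightarrow> nat set set \<Rightarrow> ram_state" where
  "graph_input n E =
     ((\<lambda>_. 0)(0 := n), \<lambda>a. if a < n * n \<and> {a div n, a mod n} \<in> E then 1 else 0)"

definition accepting :: "ram_state \<Rightarrow> bool" where
  "accepting s \<longleftrightarrow> fst s 0 \<noteq> 0"

text \<open>
  The problem whose instances are the graphs satisfying \<open>P\<close>, and whose question is \<open>Q\<close>. The
  machine need not behave in any particular way on graphs violating \<open>P\<close>.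
\<close>

definition poly_time_decidable ::
  "(nat set \<Rightarrow> nat set set \<Rightarrow> bool) \<Rightarrow> (nat set \<Rightarrow> nat set set \<Rightarrow> bool) \<Rightarrow> bool" where
  "poly_time_decidable P Q \<longleftrightarrow>
     (\<exists>(c :: ram_program) (p :: nat poly). \<forall>n E. simple_graph {..<n} E \<longrightarrow> P {..<n} E \<longrightarrow>
        (\<exists>t s. exec c (graph_input n E) t s \<and> t \<le> poly p n \<and> (accepting s \<longleftrightarrow> Q {..<n} E)))"

end

theory Submission
  imports Defs
begin

text \<open>
  The vertices of a maximal matching form a total dominating set. If equality holds, no vertex of a
  minimum maximal matching can be saved, and with minimum degree 2 this forces the matching to be
  induced, the other vertices to be independent, and, whenever two distinct matched vertices have a
  common neighbour outside the matching, their partners to be the neighbourhood of some vertex.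
  Conversely this structure implies equality. In a component the matching is determined by any one
  of its edges through a least fixed point, so it suffices to try all edges. Everything is
  expressible in first-order logic with a least fixed point, which is evaluated in polynomial time
  by nested loops.
\<close>

section \<open>Graphs attaining equality\<close>

text \<open>Computing either number is NP-hard in general, so neither is computed. Equality is
  recognised by a certificate: a \<open>paired\<close> set whose closed neighbourhood is the whole
  graph. Every condition on it concerns vertices of one component, so certificates for different
  components can be glued, and each vertex may be tested with a seed of its own. This keeps the
  number of attempts cubic instead of multiplying the choices of all components. A wrong seed does
  no harm, because the set that it generates is checked afterwards. On the machine side, programs
  for the connectives, the quantifiers and the fixed point are verified once, and the algorithm is
  then just a formula. Each quantifier costs about a factor of \<open>n\<close>, so the degree of
  the time bound depends on the fixed formula only.\<close>

text \<open>
  Up to restriction to a union of components, the paired sets are the vertex sets of the maximal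
  matchings that are minimum total dominating sets. Only the last condition is not immediate: if it
  fails for \<open>w\<close>, \<open>a\<close>, \<open>b\<close>, replacing the partners \<open>a'\<close>, \<open>b'\<close> by \<open>w\<close> gives a smaller total
  dominating set. The case \<open>a' = b\<close>, \<open>b' = a\<close> is included.
\<close>

definition paired :: "'a set \<Rightarrow> 'a set set \<Rightarrow> 'a set \<Rightarrow> bool" where
  "paired V E D \<longleftrightarrow> D \<subseteq> V
     \<and> (\<forall>a\<in>D. \<exists>b\<in>D. {a, b} \<in> E \<and> (\<forall>c\<in>D. {a, c} \<in> E \<longrightarrow> c = b))
     \<and> (\<forall>w\<in>V - D. \<forall>a\<in>D. {a, w} \<in> E \<longrightarrow> (\<forall>b\<in>V. {w, b} \<in> E \<longrightarrow> b \<in> D))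
     \<and> (\<forall>w\<in>V - D. \<forall>a\<in>D. \<forall>b\<in>D. \<forall>a'\<in>D. \<forall>b'\<in>D.
          a \<noteq> b \<and> {w, a} \<in> E \<and> {w, b} \<in> E \<and> {a, a'} \<in> E \<and> {b, b'} \<in> E \<longrightarrow>
          (\<exists>w'\<in>V. \<forall>z\<in>V. {w', z} \<in> E \<longleftrightarrow> z = a' \<or> z = b'))"

text \<open>The closed neighbourhood of \<open>D\<close>. For a \<open>paired\<close> set it is
  closed under adjacency, that is, a union of components.\<close>

definition covered :: "'a set set \<Rightarrow> 'a set \<Rightarrow> 'a set" where
  "covered E D = D \<union> {x. \<exists>a\<in>D. {a, x} \<in> E}"

lemma pairedD:
  assumes "paired V E D"
  shows paired_subset: "D \<subseteq> V"
    and paired_partner: "\<And>a. a \<in> D \<Longrightarrow> \<exists>b\<in>D. {a, b} \<in> E \<and> (\<forall>c\<in>D. {a, c} \<in> E \<longrightarrow> c = b)"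
    and paired_independent: "\<And>w a b. \<lbrakk>w \<in> V - D; a \<in> D; {a, w} \<in> E; b \<in> V; {w, b} \<in> E\<rbrakk> \<Longrightarrow> b \<in> D"
    and paired_common_neighbour:
      "\<And>w a b a' b'. \<lbrakk>w \<in> V - D; a \<in> D; b \<in> D; a' \<in> D; b' \<in> D; a \<noteq> b; {w, a} \<in> E; {w, b} \<in> E;
         {a, a'} \<in> E; {b, b'} \<in> E\<rbrakk> \<Longrightarrow> \<exists>w'\<in>V. \<forall>z\<in>V. {w', z} \<in> E \<longleftrightarrow> z = a' \<or> z = b'"
proof -
  note * = assms[unfolded paired_def]
  show "D \<subseteq> V"
    by (rule *[THEN conjunct1])
  show "\<exists>b\<in>D. {a, b} \<in> E \<and> (\<forall>c\<in>D. {a, c} \<in> E \<longrightarrow> c = b)" if "a \<in> D" for a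
    by (rule bspec[OF *[THEN conjunct2, THEN conjunct1] that])
  show "b \<in> D" if "w \<in> V - D" "a \<in> D" "{a, w} \<in> E" "b \<in> V" "{w, b} \<in> E" for w a b
    by (rule *[THEN conjunct2, THEN conjunct2, THEN conjunct1, rule_format, OF that])
  show "\<exists>w'\<in>V. \<forall>z\<in>V. {w', z} \<in> E \<longleftrightarrow> z = a' \<or> z = b'"
    if "w \<in> V - D" "a \<in> D" "b \<in> D" "a' \<in> D" "b' \<in> D" "a \<noteq> b" "{w, a} \<in> E" "{w, b} \<in> E"
      "{a, a'} \<in> E" "{b, b'} \<in> E" for w a b a' b'
    by (rule *[THEN conjunct2, THEN conjunct2, THEN conjunct2, rule_format, OF that(1-5)])
      (intro conjI that)
qed

lemma pairedI:
  assumes "D \<subseteq> V"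
    and "\<And>a. a \<in> D \<Longrightarrow> \<exists>b\<in>D. {a, b} \<in> E \<and> (\<forall>c\<in>D. {a, c} \<in> E \<longrightarrow> c = b)"
    and "\<And>w a b. \<lbrakk>w \<in> V - D; a \<in> D; {a, w} \<in> E; b \<in> V; {w, b} \<in> E\<rbrakk> \<Longrightarrow> b \<in> D"
    and "\<And>w a b a' b'. \<lbrakk>w \<in> V - D; a \<in> D; b \<in> D; a' \<in> D; b' \<in> D; a \<noteq> b; {w, a} \<in> E; {w, b} \<in> E;
         {a, a'} \<in> E; {b, b'} \<in> E\<rbrakk> \<Longrightarrow> \<exists>w'\<in>V. \<forall>z\<in>V. {w', z} \<in> E \<longleftrightarrow> z = a' \<or> z = b'"
  shows "paired V E D"
  unfolding paired_def
proof (intro conjI ballI impI assms(1,2))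
  fix w a b assume "w \<in> V - D" "a \<in> D" "{a, w} \<in> E" "b \<in> V" "{w, b} \<in> E"
  then show "b \<in> D" by (rule assms(3))
next
  fix w a b a' b'
  assume *: "w \<in> V - D" "a \<in> D" "b \<in> D" "a' \<in> D" "b' \<in> D"
    and **: "a \<noteq> b \<and> {w, a} \<in> E \<and> {w, b} \<in> E \<and> {a, a'} \<in> E \<and> {b, b'} \<in> E"
  show "\<exists>w'\<in>V. \<forall>z\<in>V. {w', z} \<in> E \<longleftrightarrow> z = a' \<or> z = b'"
    by (rule assms(4)[OF *]) (simp_all add: **)
qed

text \<open>Since \<open>a\<close> is itself a neighbour of \<open>p a\<close> inside
  \<open>D\<close>, uniqueness of that neighbour makes the partner map an involution.\<close>

lemma paired_partner_function:
  assumes "paired V E D"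
  shows "\<exists>p. \<forall>a\<in>D. p a \<in> D \<and> {a, p a} \<in> E \<and> p (p a) = a \<and> (\<forall>c\<in>D. {a, c} \<in> E \<longrightarrow> c = p a)"
proof -
  have "\<exists>p. \<forall>a\<in>D. p a \<in> D \<and> {a, p a} \<in> E \<and> (\<forall>c\<in>D. {a, c} \<in> E \<longrightarrow> c = p a)"
    using paired_partner[OF assms] by (intro bchoice ballI) blast
  then obtain p where p: "\<forall>a\<in>D. p a \<in> D \<and> {a, p a} \<in> E \<and> (\<forall>c\<in>D. {a, c} \<in> E \<longrightarrow> c = p a)"
    by (rule exE)
  have "p (p a) = a" if a: "a \<in> D" for a
  proof -
    have "p a \<in> D" "{p a, a} \<in> E" using p a by (simp_all add: insert_commute)
    then show ?thesis using p a by metis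
  qed
  then show ?thesis using p by (intro exI[of _ p] ballI) simp
qed

section \<open>Matchings, total dominating sets and the lower bound from paired sets\<close>

context
  fixes V :: "'a set" and E :: "'a set set"
  assumes graph: "simple_graph V E"
begin

lemma finite_vertices: "finite V"
  using graph by (simp add: simple_graph_def)

lemma edge_ends: "{a, b} \<in> E \<Longrightarrow> a \<in> V \<and> b \<in> V \<and> a \<noteq> b"
  using graph unfolding simple_graph_def by fastforce

lemma edgeE:
  assumes "e \<in> E"
  obtains a b where "e = {a, b}" "a \<noteq> b" "a \<in> V" "b \<in> V"
proof -
  have "e \<subseteq> V" "card e = 2"
    using graph assms unfolding simple_graph_def by auto
  then show ?thesis
    using that by (auto simp: card_2_iff)
qed

lemma edges_subset_Pow: "E \<subseteq> Pow V"
  using graph unfolding simple_graph_def by auto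

lemma finite_edges: "finite E"
  using finite_subset[OF edges_subset_Pow] finite_vertices by simp

lemma vertex_degree_eq: "vertex_degree E v = card {u. {v, u} \<in> E}"
proof -
  have "{e \<in> E. v \<in> e} = (\<lambda>u. {v, u}) ` {u. {v, u} \<in> E}"
  proof (intro equalityI subsetI)
    fix e assume e: "e \<in> {e \<in> E. v \<in> e}"
    then obtain a b where "e = {a, b}" by (blast elim: edgeE)
    then have "e = {v, a} \<or> e = {v, b}" using e by auto
    then show "e \<in> (\<lambda>u. {v, u}) ` {u. {v, u} \<in> E}" using e by auto
  qed auto
  moreover have "inj_on (\<lambda>u. {v, u}) {u. {v, u} \<in> E}"
    by (auto simp: inj_on_def doubleton_eq_iff)
  ultimately show ?thesis
    by (simp add: vertex_degree_def card_image)
qed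

lemma card_matching_vertices:
  assumes "matching E M"
  shows "card (\<Union>M) = 2 * card M"
proof -
  have "M \<subseteq> E" "pairwise disjnt M" using assms by (auto simp: matching_def)
  have "card (\<Union>M) = (\<Sum>e\<in>M. card e)"
    using \<open>pairwise disjnt M\<close> \<open>M \<subseteq> E\<close> finite_vertices edges_subset_Pow
    by (intro card_Union_disjoint) (auto intro: finite_subset)
  also have "\<dots> = (\<Sum>e\<in>M. 2)"
    using \<open>M \<subseteq> E\<close> graph by (intro sum.cong) (auto simp: simple_graph_def)
  finally show ?thesis by simp
qed

lemma matching_partner:
  assumes "matching E M" "a \<in> \<Union>M"
  shows "\<exists>b\<in>\<Union>M. {a, b} \<in> M"
proof -
  from assms(2) obtain e where e: "e \<in> M" "a \<in> e" by blast
  then have "e \<in> E" using assms(1) by (auto simp: matching_def)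
  then obtain x y where xy: "e = {x, y}" "x \<noteq> y" by (rule edgeE)
  show ?thesis
  proof (cases "a = x")
    case True
    then show ?thesis using e xy by blast
  next
    case False
    then show ?thesis using e xy by (metis UnionI insertE insertI1 insert_commute singletonD)
  qed
qed

lemma maximal_matching_independent:
  assumes "maximal_matching E M" "{a, b} \<in> E" "a \<notin> \<Union>M"
  shows "b \<in> \<Union>M"
proof (rule ccontr)
  assume b: "b \<notin> \<Union>M"
  have M: "M \<subseteq> E" "pairwise disjnt M" and max: "\<And>N. matching E N \<Longrightarrow> \<not> M \<subset> N"
    using assms(1) by (auto simp: maximal_matching_def matching_def)
  have "matching E (insert {a, b} M)"
    using M assms b unfolding matching_def
    by (auto simp: pairwise_insert disjnt_def)
  moreover have "M \<subset> insert {a, b} M" using b by blast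
  ultimately show False using max by blast
qed

lemma maximal_matching_exists: "\<exists>M. maximal_matching E M"
proof -
  have "finite {M. matching E M}"
    by (rule finite_subset[of _ "Pow E"]) (auto simp: matching_def finite_edges)
  moreover have "{} \<in> {M. matching E M}" by (simp add: matching_def)
  ultimately obtain M where "M \<in> {M. matching E M}" "\<forall>N\<in>{M. matching E M}. M \<subseteq> N \<longrightarrow> N = M"
    using finite_has_maximal[of "{M. matching E M}"] by (metis empty_iff)
  then show ?thesis unfolding maximal_matching_def by blast
qed

lemma finite_maximal_matching_cards: "finite {card M |M. maximal_matching E M}"
proof -
  have "{card M |M. maximal_matching E M} \<subseteq> card ` Pow E"
    by (auto simp: maximal_matching_def matching_def)
  then show ?thesis using finite_edges finite_subset by blast
qed

lemma min_maximal_matching_number_le: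
  "maximal_matching E M \<Longrightarrow> min_maximal_matching_number E \<le> card M"
  unfolding min_maximal_matching_number_def
  using finite_maximal_matching_cards by (intro Min_le) auto

lemma min_maximal_matching_obtain:
  obtains M where "maximal_matching E M" "card M = min_maximal_matching_number E"
proof -
  have "min_maximal_matching_number E \<in> {card M |M. maximal_matching E M}"
    unfolding min_maximal_matching_number_def
    using maximal_matching_exists finite_maximal_matching_cards by (intro Min_in) auto
  then show ?thesis using that by auto
qed

lemma finite_tds_cards: "finite {card S |S. total_dominating_set V E S}"
proof -
  have "{card S |S. total_dominating_set V E S} \<subseteq> card ` Pow V"
    by (auto simp: total_dominating_set_def)
  then show ?thesis using finite_vertices finite_subset by blast
qed

lemma total_domination_number_le:
  "total_dominating_set V E S \<Longrightarrow> total_domination_number V E \<le> card S"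
  unfolding total_domination_number_def
  using finite_tds_cards by (intro Min_le) auto

text \<open>
  A vertex of \<open>D\<close> outside \<open>S\<close> is charged to a vertex of \<open>S\<close> dominating its partner. If two were
  charged to the same vertex, the common neighbour condition would give a vertex that is not
  dominated by \<open>S\<close>.
\<close>

lemma paired_card_le_total_dominating:
  assumes "paired V E D" "total_dominating_set V E S"
  shows "card D \<le> card S"
proof -
  have DV: "D \<subseteq> V" by (rule paired_subset[OF assms(1)])
  have SV: "S \<subseteq> V" and dom: "\<And>v. v \<in> V \<Longrightarrow> \<exists>u\<in>S. {u, v} \<in> E"
    using assms(2) by (auto simp: total_dominating_set_def)
  obtain p where "\<forall>a\<in>D. p a \<in> D \<and> {a, p a} \<in> E \<and> p (p a) = a \<and> (\<forall>c\<in>D. {a, c} \<in> E \<longrightarrow> c = p a)"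
    using paired_partner_function[OF assms(1)] by (rule exE)
  then have p: "\<And>a. a \<in> D \<Longrightarrow> p a \<in> D" "\<And>a. a \<in> D \<Longrightarrow> {a, p a} \<in> E"
    and pp: "\<And>a. a \<in> D \<Longrightarrow> p (p a) = a"
    and p_unique: "\<And>a c. a \<in> D \<Longrightarrow> c \<in> D \<Longrightarrow> {a, c} \<in> E \<Longrightarrow> c = p a"
    by simp_all
  have "\<exists>w. w \<in> S - D \<and> {w, p a} \<in> E" if a: "a \<in> D - S" for a
  proof -
    obtain w where w: "w \<in> S" "{w, p a} \<in> E" using dom p a DV by blast
    \<comment> \<open>The only neighbour of \<open>p a\<close> inside \<open>D\<close> is
      \<open>a\<close>, which is not in \<open>S\<close>.\<close>
    have "w \<notin> D"
      using p_unique[of "p a" w] pp[of a] p(1)[of a] a w by (auto simp: insert_commute)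
    then show ?thesis using w by blast
  qed
  then obtain f where f: "\<And>a. a \<in> D - S \<Longrightarrow> f a \<in> S - D \<and> {f a, p a} \<in> E" by metis
  have "inj_on f (D - S)"
  proof (rule inj_onI, rule ccontr)
    fix a b assume ab: "a \<in> D - S" "b \<in> D - S" "f a = f b" "a \<noteq> b"
    have "p a \<noteq> p b"
      using pp[of a] pp[of b] ab by auto
    then obtain w' where "w' \<in> V" "\<And>z. z \<in> V \<Longrightarrow> {w', z} \<in> E \<longleftrightarrow> z = a \<or> z = b"
      using paired_common_neighbour[OF assms(1), of "f a" "p a" "p b" a b]
        f[of a] f[of b] p[of a] p[of b] ab SV
      by (auto simp: insert_commute)
    then show False using dom[of w'] ab SV by (auto simp: insert_commute)
  qed
  moreover have "f ` (D - S) \<subseteq> S - D" using f by blast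
  moreover have "finite S" "finite D" using SV DV finite_vertices finite_subset by blast+
  ultimately have "card (D - S) \<le> card (S - D)" by (intro card_inj_on_le) auto
  then show ?thesis
    using card_Int_Diff[OF \<open>finite D\<close>, of S] card_Int_Diff[OF \<open>finite S\<close>, of D]
    by (simp add: Int_commute)
qed

section \<open>Equality under minimum degree at least 2\<close>

context
  assumes degree_ge_2: "min_degree V E \<ge> 2"
begin

text \<open>The form in which the degree bound enters the exchange arguments: a vertex that loses
  one chosen neighbour still has another one.\<close>

lemma neighbour_outside:
  assumes "v \<in> V"
  shows "\<exists>u. {v, u} \<in> E \<and> u \<noteq> b"
proof -
  have "2 \<le> vertex_degree E v"
    using degree_ge_2 finite_vertices assms unfolding min_degree_def
    by (meson Min_le finite_imageI imageI le_trans)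
  then have "\<not> {u. {v, u} \<in> E} \<subseteq> {b}"
    using card_mono[of "{b}" "{u. {v, u} \<in> E}"] by (auto simp: vertex_degree_eq)
  then show ?thesis by blast
qed

text \<open>If every neighbour of \<open>v\<close> were \<open>a\<close> or \<open>b\<close>, a
  neighbour other than \<open>a\<close> would be \<open>b\<close> and one other than
  \<open>b\<close> would be \<open>a\<close>, so the neighbourhood would be exactly
  \<open>{a, b}\<close>.\<close>

lemma neighbour_outside_pair:
  assumes "v \<in> V" "\<not> (\<forall>z. {v, z} \<in> E \<longleftrightarrow> z = a \<or> z = b)"
  shows "\<exists>u. {v, u} \<in> E \<and> u \<noteq> a \<and> u \<noteq> b"
  by (metis assms neighbour_outside)

lemma maximal_matching_total_dominating:
  assumes "maximal_matching E M"
  shows "total_dominating_set V E (\<Union>M)"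
proof -
  have M: "matching E M" using assms by (simp add: maximal_matching_def)
  have "\<exists>u\<in>\<Union>M. {u, v} \<in> E" if "v \<in> V" for v
  proof (cases "v \<in> \<Union>M")
    case True
    then obtain b where "{v, b} \<in> M" "b \<in> \<Union>M" using matching_partner M by blast
    then show ?thesis using M by (auto simp: matching_def insert_commute)
  next
    case False
    obtain u where "{v, u} \<in> E" using neighbour_outside \<open>v \<in> V\<close> by blast
    then show ?thesis
      using maximal_matching_independent[OF assms _ False] by (auto simp: insert_commute)
  qed
  then show ?thesis
    using M edges_subset_Pow by (auto simp: total_dominating_set_def matching_def)
qed

lemma total_domination_number_obtain:
  obtains S where "total_dominating_set V E S" "card S = total_domination_number V E"
proof -
  have "total_domination_number V E \<in> {card S |S. total_dominating_set V E S}"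
    unfolding total_domination_number_def
    using maximal_matching_exists maximal_matching_total_dominating finite_tds_cards
    by (intro Min_in) auto
  then show ?thesis using that by auto
qed

lemma total_domination_le_twice_matching:
  "total_domination_number V E \<le> 2 * min_maximal_matching_number E"
proof -
  obtain M where M: "maximal_matching E M" "card M = min_maximal_matching_number E"
    by (rule min_maximal_matching_obtain)
  then have "total_domination_number V E \<le> card (\<Union>M)"
    by (intro total_domination_number_le maximal_matching_total_dominating)
  then show ?thesis
    using M card_matching_vertices by (simp add: maximal_matching_def)
qed

text \<open>The edges inside \<open>D\<close> form a maximal matching with vertex set
  \<open>D\<close>. So \<open>card D\<close> is at least twice the matching number and at most the
  total domination number, which in turn is at most twice the matching number.\<close>

lemma paired_imp_equality:
  assumes "paired V E D" "V \<subseteq> covered E D"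
  shows "total_domination_number V E = 2 * min_maximal_matching_number E"
proof -
  have DV: "D \<subseteq> V" by (rule paired_subset[OF assms(1)])
  have partner: "\<exists>b\<in>D. {a, b} \<in> E \<and> (\<forall>c\<in>D. {a, c} \<in> E \<longrightarrow> c = b)" if "a \<in> D" for a
    by (rule paired_partner[OF assms(1) that])
  \<comment> \<open>As everything is covered, \<open>w\<close> has a neighbour in \<open>D\<close>,
    which the independence condition asks for.\<close>
  have indep: "b \<in> D" if "w \<in> V - D" "{w, b} \<in> E" for w b
    using paired_independent[OF assms(1) that(1) _ _ _ that(2)] assms(2) that edge_ends
    unfolding covered_def by blast
  define M where "M = {e \<in> E. e \<subseteq> D}"
  have "disjnt e f" if ef: "e \<in> M" "f \<in> M" "e \<noteq> f" for e f
  proof (rule ccontr)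
    assume "\<not> disjnt e f"
    then obtain a where a: "a \<in> e" "a \<in> f" by (auto simp: disjnt_def)
    obtain b where "e = {a, b}"
      using a(1) ef(1) edgeE[of e] unfolding M_def by (metis (no_types, lifting) insertE insert_commute mem_Collect_eq singletonD)
    moreover obtain c where "f = {a, c}"
      using a(2) ef(2) edgeE[of f] unfolding M_def by (metis (no_types, lifting) insertE insert_commute mem_Collect_eq singletonD)
    ultimately show False
      using ef partner[of a] unfolding M_def by auto
  qed
  then have M: "matching E M"
    by (auto simp: matching_def M_def pairwise_def)
  have UM: "\<Union>M = D"
    using partner unfolding M_def by blast
  have "maximal_matching E M"
    unfolding maximal_matching_def
  proof (intro conjI M notI)
    assume "\<exists>N. matching E N \<and> M \<subset> N"
    then obtain N e where N: "matching E N" "M \<subset> N" "e \<in> N" "e \<notin> M" by blast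
    then have "e \<in> E" by (auto simp: matching_def)
    then obtain a b where ab: "e = {a, b}" "a \<noteq> b" "a \<in> V" "b \<in> V" by (rule edgeE)
    then have "a \<in> D \<or> b \<in> D" using indep \<open>e \<in> E\<close> by blast
    then obtain f where f: "f \<in> M" "\<not> disjnt e f"
      unfolding UM[symmetric] ab disjnt_def by blast
    then have "e = f" using N unfolding matching_def pairwise_def by blast
    then show False using f N by blast
  qed
  then have "2 * min_maximal_matching_number E \<le> card D"
    using min_maximal_matching_number_le card_matching_vertices[OF M] UM by fastforce
  moreover have "card D \<le> total_domination_number V E"
    by (metis total_domination_number_obtain paired_card_le_total_dominating assms(1))
  ultimately show ?thesis using total_domination_le_twice_matching by linarith
qed

lemma equality_imp_paired:
  assumes eq: "total_domination_number V E = 2 * min_maximal_matching_number E"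
  shows "\<exists>D. paired V E D \<and> V \<subseteq> covered E D"
proof -
  obtain M where M: "maximal_matching E M" "card M = min_maximal_matching_number E"
    by (rule min_maximal_matching_obtain)
  define D where "D = \<Union>M"
  have matching: "matching E M" and ME: "M \<subseteq> E"
    using M by (auto simp: maximal_matching_def matching_def)
  have DV: "D \<subseteq> V" using ME edges_subset_Pow by (auto simp: D_def)
  then have finD: "finite D" using finite_vertices finite_subset by blast
  have cardD: "card D = total_domination_number V E"
    using M card_matching_vertices[OF matching] eq by (simp add: D_def)
  have indep: "b \<in> D" if "{w, b} \<in> E" "w \<notin> D" for w b
    using maximal_matching_independent[OF M(1)] that unfolding D_def by blast
  have small: "\<not> total_dominating_set V E S" if "card S < card D" for S
    using total_domination_number_le[of S] that cardD by linarith
  obtain p where p: "\<And>a. a \<in> D \<Longrightarrow> p a \<in> D \<and> {a, p a} \<in> M"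
    using matching_partner[OF matching] unfolding D_def by metis
  have pE: "{a, p a} \<in> E" if "a \<in> D" for a using p ME that by blast
  have pp: "p (p a) = a" if "a \<in> D" for a
  proof -
    have "\<not> disjnt {a, p a} {p a, p (p a)}" by (simp add: disjnt_def)
    then have "{a, p a} = {p a, p (p a)}"
      using p that matching unfolding matching_def pairwise_def by meson
    then show ?thesis by (auto simp: doubleton_eq_iff)
  qed
  have unique: "c = p a" if ac: "a \<in> D" "c \<in> D" "{a, c} \<in> E" for a c
  proof (rule ccontr)
    assume ne: "c \<noteq> p a"
    \<comment> \<open>Inside \<open>D\<close>, only \<open>a\<close> relies on \<open>p a\<close>,
      and \<open>c\<close> dominates \<open>a\<close> as well. A vertex outside \<open>D\<close> has
      a neighbour other than \<open>p a\<close>, again in \<open>D\<close>.\<close>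
    have "\<exists>u\<in>D - {p a}. {u, v} \<in> E" if "v \<in> V" for v
    proof (cases "v \<in> D")
      case True
      show ?thesis
      proof (cases "v = a")
        case True
        then show ?thesis using ne ac by (auto simp: insert_commute)
      next
        case False
        then have "p v \<noteq> p a" using pp[of v] pp[of a] \<open>v \<in> D\<close> ac by metis
        then show ?thesis using p[of v] pE[of v] \<open>v \<in> D\<close> by (auto simp: insert_commute)
      qed
    next
      case False
      obtain u where "{v, u} \<in> E" "u \<noteq> p a" using neighbour_outside \<open>v \<in> V\<close> by blast
      then show ?thesis using indep False by (auto simp: insert_commute)
    qed
    then have "total_dominating_set V E (D - {p a})"
      using DV by (auto simp: total_dominating_set_def)
    moreover have "card (D - {p a}) < card D"
      using p ac finD by (meson card_Diff1_less)
    ultimately show False using small by blast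
  qed
  have pair: "\<exists>w'\<in>V. \<forall>z. {w', z} \<in> E \<longleftrightarrow> z = p a \<or> z = p b"
    if w: "w \<in> V - D" "a \<in> D" "b \<in> D" "a \<noteq> b" "{w, a} \<in> E" "{w, b} \<in> E" for w a b
  proof (rule ccontr)
    assume none: "\<not> ?thesis"
    define S where "S = insert w (D - {p a, p b})"
    have ne: "p a \<noteq> p b" using pp[of a] pp[of b] w by metis
    \<comment> \<open>\<open>w\<close> takes over \<open>a\<close> and \<open>b\<close>. A vertex
      outside \<open>D\<close> left without a neighbour in \<open>S\<close> would have neighbourhood
      exactly \<open>{p a, p b}\<close>, which \<open>none\<close> excludes.\<close>
    have "\<exists>u\<in>S. {u, v} \<in> E" if "v \<in> V" for v
    proof (cases "v \<in> D")
      case True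
      show ?thesis
      proof (cases "v = a \<or> v = b")
        case True
        then show ?thesis using w unfolding S_def by blast
      next
        case False
        then have "p v \<noteq> p a" "p v \<noteq> p b" using pp[of v] pp[of a] pp[of b] \<open>v \<in> D\<close> w by metis+
        then show ?thesis using p[of v] pE[of v] \<open>v \<in> D\<close> unfolding S_def by (auto simp: insert_commute)
      qed
    next
      case False
      obtain u where "{v, u} \<in> E" "u \<noteq> p a" "u \<noteq> p b"
        using neighbour_outside_pair[of v "p a" "p b"] \<open>v \<in> V\<close> none by blast
      then show ?thesis using indep False unfolding S_def by (auto simp: insert_commute)
    qed
    then have "total_dominating_set V E S"
      using DV w by (auto simp: total_dominating_set_def S_def)
    moreover have "card S < card D"
    proof -
      have sub: "{p a, p b} \<subseteq> D" using p w by blast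
      then have "card {p a, p b} \<le> card D" using finD card_mono by blast
      then show ?thesis
        unfolding S_def using finD sub ne w by (simp add: card_Diff_subset card_insert_if)
    qed
    ultimately show False using small by blast
  qed
  have "paired V E D"
  proof (rule pairedI[OF DV])
    fix a assume "a \<in> D"
    then show "\<exists>b\<in>D. {a, b} \<in> E \<and> (\<forall>c\<in>D. {a, c} \<in> E \<longrightarrow> c = b)"
      using p pE unique by blast
  next
    fix w b assume "w \<in> V - D" "{w, b} \<in> E"
    then show "b \<in> D" using indep by blast
  next
    fix w a b a' b'
    assume *: "w \<in> V - D" "a \<in> D" "b \<in> D" "a' \<in> D" "b' \<in> D" "a \<noteq> b" "{w, a} \<in> E" "{w, b} \<in> E"
      "{a, a'} \<in> E" "{b, b'} \<in> E"
    then have "a' = p a" "b' = p b" using unique by blast+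
    then show "\<exists>w'\<in>V. \<forall>z\<in>V. {w', z} \<in> E \<longleftrightarrow> z = a' \<or> z = b'"
      using pair[of w a b] * by blast
  qed
  moreover have "V \<subseteq> covered E D"
    using neighbour_outside indep unfolding covered_def by (fastforce simp: insert_commute)
  ultimately show ?thesis by blast
qed

end

section \<open>Gluing paired sets over the components\<close>

lemma covered_closed:
  assumes "paired V E D" "{y, z} \<in> E" "y \<in> covered E D"
  shows "z \<in> covered E D"
  \<comment> \<open>If \<open>y\<close> is outside \<open>D\<close>, it has a neighbour in
    \<open>D\<close>, and then all its neighbours lie in \<open>D\<close>.\<close>
  using assms(2,3) paired_independent[OF assms(1), of y _ z] edge_ends[of y z]
  unfolding covered_def by blast

text \<open>
  Adjacent vertices are covered by the same paired sets, so Hilbert choice picks the same set for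
  all vertices of a component.
\<close>

lemma paired_combine:
  assumes "\<And>x. x \<in> V \<Longrightarrow> \<exists>D. paired V E D \<and> x \<in> covered E D"
  shows "\<exists>D. paired V E D \<and> V \<subseteq> covered E D"
proof -
  define R where "R x = (SOME D. paired V E D \<and> x \<in> covered E D)" for x
  have R: "paired V E (R x)" "x \<in> covered E (R x)" if "x \<in> V" for x
    using someI_ex[OF assms[OF that]] by (simp_all add: R_def)
  have R_adj: "R y = R x" if "{x, y} \<in> E" for x y
  proof -
    have "{y, x} \<in> E" using that by (simp add: insert_commute)
    then have "(paired V E D \<and> y \<in> covered E D) = (paired V E D \<and> x \<in> covered E D)" for D
      using covered_closed[of D y x] covered_closed[of D x y] that by blast
    then show ?thesis by (simp add: R_def)
  qed
  define D where "D = {x \<in> V. x \<in> R x}"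
  have "paired V E D"
  proof (rule pairedI)
    fix a assume a: "a \<in> D"
    then have "a \<in> V" "a \<in> R a" by (simp_all add: D_def)
    then obtain b where b: "b \<in> R a" "{a, b} \<in> E" "\<forall>c\<in>R a. {a, c} \<in> E \<longrightarrow> c = b"
      using paired_partner[OF R(1)[of a], of a] by blast
    moreover have "b \<in> D" using b(1) R_adj[OF b(2)] edge_ends[OF b(2)] by (simp add: D_def)
    moreover have "c = b" if "c \<in> D" "{a, c} \<in> E" for c
      using that b(3) R_adj[of a c] by (simp add: D_def)
    ultimately show "\<exists>b\<in>D. {a, b} \<in> E \<and> (\<forall>c\<in>D. {a, c} \<in> E \<longrightarrow> c = b)" by blast
  next
    fix w a b assume *: "w \<in> V - D" "a \<in> D" "{a, w} \<in> E" "b \<in> V" "{w, b} \<in> E"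
    have "R a = R w" "R b = R w" using R_adj[of a w] R_adj[of w b] * by simp_all
    then show "b \<in> D"
      using paired_independent[OF R(1)[of w], of w a b] * by (simp add: D_def)
  next
    fix w a b a' b'
    assume *: "w \<in> V - D" "a \<in> D" "b \<in> D" "a' \<in> D" "b' \<in> D" "a \<noteq> b" "{w, a} \<in> E" "{w, b} \<in> E"
      "{a, a'} \<in> E" "{b, b'} \<in> E"
    \<comment> \<open>The whole configuration lies in one component, so the single set
      \<open>R w\<close> decides every membership in it.\<close>
    have "R a = R w" "R b = R w" "R a' = R w" "R b' = R w"
      using R_adj[of w a] R_adj[of w b] R_adj[of a a'] R_adj[of b b'] * by simp_all
    then have "w \<in> V - R w" "a \<in> R w" "b \<in> R w" "a' \<in> R w" "b' \<in> R w"
      using *(1-5) by (simp_all add: D_def)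
    then show "\<exists>w'\<in>V. \<forall>z\<in>V. {w', z} \<in> E \<longleftrightarrow> z = a' \<or> z = b'"
      using *(1,6-) by (intro paired_common_neighbour[OF R(1)[of w], of w a b a' b']) simp_all
  qed (auto simp: D_def)
  moreover have "x \<in> covered E D" if x: "x \<in> V" for x
  proof (cases "x \<in> R x")
    case True
    then show ?thesis using x by (simp add: D_def covered_def)
  next
    case False
    then obtain a where "a \<in> R x" "{a, x} \<in> E" using R(2)[OF x] by (auto simp: covered_def)
    moreover from this have "a \<in> D" using R_adj[of a x] edge_ends[of a x] by (simp add: D_def)
    ultimately show ?thesis by (auto simp: covered_def)
  qed
  ultimately show ?thesis by blast
qed

end

section \<open>The fixed point generated by a seed\<close>

definition spread :: "'a set \<Rightarrow> 'a set set \<Rightarrow> 'a \<Rightarrow> 'a \<Rightarrow> 'a set \<Rightarrow> 'a set" where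
  "spread V E u v X = {x \<in> V. x = u \<or> x = v \<or>
     (\<exists>b\<in>V. \<exists>b'\<in>V. \<exists>w\<in>V. b \<in> X \<and> b' \<in> X \<and> {b, b'} \<in> E \<and> {b, w} \<in> E \<and> w \<noteq> b' \<and> {w, x} \<in> E)}"

text \<open>That \<open>w\<close> lies outside the pairing is expressed by
  \<open>w \<noteq> b'\<close> and not by \<open>w \<notin> X\<close>, so \<open>X\<close> occurs
  only positively.\<close>

lemma mono_spread: "mono (spread V E u v)"
  unfolding spread_def by (rule monoI) blast

lemma lfp_spread_subset: "lfp (spread V E u v) \<subseteq> V"
  by (rule lfp_lowerbound) (auto simp: spread_def)

text \<open>
  Starting from one edge of the pairing, the neighbours of a known pair must be outside, their
  neighbours must be inside, and the condition on common neighbours makes the partners of the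
  latter known as well.
\<close>

lemma paired_lfp_spread:
  assumes graph: "simple_graph V E"
    and D: "paired V E D" "V \<subseteq> covered E D" and x: "x \<in> V"
  shows "\<exists>u\<in>V. \<exists>v\<in>V. paired V E (lfp (spread V E u v)) \<and> x \<in> covered E (lfp (spread V E u v))"
proof -
  note edge_ends = edge_ends[OF graph]
  have DV: "D \<subseteq> V" by (rule paired_subset[OF D(1)])
  obtain p where "\<forall>a\<in>D. p a \<in> D \<and> {a, p a} \<in> E \<and> p (p a) = a \<and> (\<forall>c\<in>D. {a, c} \<in> E \<longrightarrow> c = p a)"
    using paired_partner_function[OF D(1)] by (rule exE)
  then have p: "\<And>a. a \<in> D \<Longrightarrow> p a \<in> D" "\<And>a. a \<in> D \<Longrightarrow> {a, p a} \<in> E"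
    and pp: "\<And>a. a \<in> D \<Longrightarrow> p (p a) = a"
    and p_unique: "\<And>a c. a \<in> D \<Longrightarrow> c \<in> D \<Longrightarrow> {a, c} \<in> E \<Longrightarrow> c = p a"
    by simp_all
  have indep: "b \<in> D" if "w \<in> V - D" "{w, b} \<in> E" for w b
    using paired_independent[OF D(1) that(1) _ _ _ that(2)] D(2) that edge_ends
    unfolding covered_def by blast
  obtain u where u: "u \<in> D" "u = x \<or> {u, x} \<in> E"
    using D(2) x unfolding covered_def by blast
  let ?v = "p u"
  let ?F = "spread V E u ?v"
  let ?C = "lfp ?F"
  have unfold: "?F ?C = ?C" by (rule lfp_fixpoint[OF mono_spread])
  have outside: "w \<in> V - D" if "b \<in> D" "{b, w} \<in> E" "w \<noteq> p b" for b w
    using that p_unique edge_ends by blast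
  have CD: "?C \<subseteq> D"
  proof (rule lfp_lowerbound, rule subsetI)
    fix y assume "y \<in> ?F D"
    then consider "y = u" | "y = ?v" | b b' w where "b \<in> D" "b' \<in> D" "{b, b'} \<in> E" "{b, w} \<in> E"
        "w \<noteq> b'" "{w, y} \<in> E"
      unfolding spread_def by blast
    then show "y \<in> D"
    proof cases
      case 3
      then have "w \<noteq> p b" using p_unique[of b b'] by simp
      then show ?thesis using outside[of b w] indep[of w y] 3 by blast
    qed (use u p in simp_all)
  qed
  have step: "y \<in> ?C" if "b \<in> ?C" "p b \<in> ?C" "{b, w} \<in> E" "w \<noteq> p b" "{w, y} \<in> E" for b w y
  proof -
    have "y \<in> ?F ?C"
      using that p(2)[of b] CD edge_ends[of b "p b"] edge_ends[of b w] edge_ends[of w y]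
      unfolding spread_def by blast
    then show ?thesis using unfold by simp
  qed
  have ends: "u \<in> ?C" "?v \<in> ?C"
  proof -
    have "u \<in> ?F ?C" "?v \<in> ?F ?C" using u p(1)[of u] DV unfolding spread_def by blast+
    then show "u \<in> ?C" "?v \<in> ?C" using unfold by simp_all
  qed
  have partner_C: "p y \<in> ?C" if y: "y \<in> ?C" for y
  proof -
    have "y \<in> ?F ?C" using y unfold by simp
    then consider "y = u" | "y = ?v" | b b' w where "b \<in> ?C" "b' \<in> ?C" "{b, b'} \<in> E" "{b, w} \<in> E"
        "w \<noteq> b'" "{w, y} \<in> E"
      unfolding spread_def by blast
    then show ?thesis
    proof cases
      case 3
      then have b': "b' = p b" and bD: "b \<in> D" "y \<in> D" using p_unique[of b b'] CD y by blast+
      have w: "w \<in> V - D" using outside[of b w] 3 b' bD by blast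
      show ?thesis
      proof (cases "y = b")
        case True
        then show ?thesis using 3 b' by simp
      next
        case False
        have "{w, b} \<in> E" using 3 by (simp add: insert_commute)
        \<comment> \<open>\<open>y\<close> and \<open>b\<close> share the outside neighbour
          \<open>w\<close>, so some \<open>w'\<close> has their partners as its only neighbours. It
          differs from \<open>b\<close>, which is adjacent to \<open>w\<close> outside
          \<open>D\<close>. Hence the known pair of \<open>p b\<close> and \<open>b\<close> reaches
          \<open>p y\<close> through \<open>w'\<close>.\<close>
        then obtain w' where w': "\<And>z. z \<in> V \<Longrightarrow> {w', z} \<in> E \<longleftrightarrow> z = p y \<or> z = p b"
          using paired_common_neighbour[OF D(1) w bD(2,1) p(1)[OF bD(2)] p(1)[OF bD(1)] False]
            3 p(2) bD by blast
        have "w' \<noteq> b" using w'[of w] 3 w p(1) bD by auto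
        moreover have "{p b, w'} \<in> E" "{w', p y} \<in> E"
          using w'[of "p b"] w'[of "p y"] p(1) bD DV by (auto simp: insert_commute)
        ultimately show ?thesis using step[of "p b" w' "p y"] 3 b' pp[OF bD(1)] by simp
      qed
    qed (use ends pp u in simp_all)
  qed
  have "paired V E ?C"
  proof (rule pairedI)
    show "?C \<subseteq> V" using CD DV by blast
  next
    fix a assume "a \<in> ?C"
    then show "\<exists>b\<in>?C. {a, b} \<in> E \<and> (\<forall>c\<in>?C. {a, c} \<in> E \<longrightarrow> c = b)"
      using partner_C[of a] p(2)[of a] p_unique[of a] CD by blast
  next
    fix w a b assume *: "w \<in> V - ?C" "a \<in> ?C" "{a, w} \<in> E" "b \<in> V" "{w, b} \<in> E"
    then show "b \<in> ?C" using step[of a w b] partner_C[of a] by blast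
  next
    fix w a b a' b'
    assume *: "w \<in> V - ?C" "a \<in> ?C" "b \<in> ?C" "a' \<in> ?C" "b' \<in> ?C" "a \<noteq> b" "{w, a} \<in> E" "{w, b} \<in> E"
      "{a, a'} \<in> E" "{b, b'} \<in> E"
    have "{a, w} \<in> E" using * by (simp add: insert_commute)
    \<comment> \<open>The partner of \<open>a\<close> lies in the fixed point and \<open>w\<close>
      does not, so \<open>w\<close> is outside \<open>D\<close> and not merely outside the fixed
      point.\<close>
    then have "w \<in> V - D" using outside[of a w] * CD partner_C[of a] by blast
    then show "\<exists>w'\<in>V. \<forall>z\<in>V. {w', z} \<in> E \<longleftrightarrow> z = a' \<or> z = b'"
      using * CD by (intro paired_common_neighbour[OF D(1), of w a b a' b']) auto
  qed
  moreover have "x \<in> covered E ?C" using u ends by (auto simp: covered_def)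
  ultimately show ?thesis using u p(1) DV by blast
qed

text \<open>From right to left, every generated set that passes the test is a certificate for the
  components it covers, and \<open>paired_combine\<close> glues these.\<close>

lemma equality_iff_spread:
  assumes "simple_graph V E" "2 \<le> min_degree V E"
  shows "total_domination_number V E = 2 * min_maximal_matching_number E \<longleftrightarrow>
    (\<forall>x\<in>V. \<exists>u\<in>V. \<exists>v\<in>V. paired V E (lfp (spread V E u v)) \<and> x \<in> covered E (lfp (spread V E u v)))"
    (is "?eq \<longleftrightarrow> ?spread")
proof
  assume ?eq
  then show ?spread
    using equality_imp_paired[OF assms] paired_lfp_spread[OF assms(1)] by blast
next
  assume ?spread
  then have "\<exists>D. paired V E D \<and> V \<subseteq> covered E D"
    by (intro paired_combine[OF assms(1)]) blast
  then show ?eq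
    using paired_imp_equality[OF assms] by blast
qed

section \<open>Evaluating fixed point queries\<close>

definition runs ::
  "ram_program \<Rightarrow> (nat \<Rightarrow> nat) \<Rightarrow> (nat \<Rightarrow> nat) \<Rightarrow> nat \<Rightarrow> ((nat \<Rightarrow> nat) \<Rightarrow> (nat \<Rightarrow> nat) \<Rightarrow> bool) \<Rightarrow> bool"
  where "runs c r m T Q \<longleftrightarrow> (\<exists>t r' m'. exec c (r, m) t (r', m') \<and> t \<le> T \<and> Q r' m')"

lemma runs_mono:
  "runs c r m T Q \<Longrightarrow> T \<le> U \<Longrightarrow> (\<And>r' m'. Q r' m' \<Longrightarrow> R r' m') \<Longrightarrow> runs c r m U R"
  unfolding runs_def by (meson le_trans)

lemma runs_Const: "0 < T \<Longrightarrow> Q (r(i := k)) m \<Longrightarrow> runs (Const i k) r m T Q"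
  unfolding runs_def using exec.Const[of i k r m] by (metis One_nat_def Suc_leI)

lemma runs_Add: "0 < T \<Longrightarrow> Q (r(i := r j + r k)) m \<Longrightarrow> runs (Add i j k) r m T Q"
  unfolding runs_def using exec.Add[of i j k r m] by (metis One_nat_def Suc_leI)

lemma runs_Sub: "0 < T \<Longrightarrow> Q (r(i := r j - r k)) m \<Longrightarrow> runs (Sub i j k) r m T Q"
  unfolding runs_def using exec.Sub[of i j k r m] by (metis One_nat_def Suc_leI)

lemma runs_Load: "0 < T \<Longrightarrow> Q (r(i := m (r j))) m \<Longrightarrow> runs (Load i j) r m T Q"
  unfolding runs_def using exec.Load[of i j r m] by (metis One_nat_def Suc_leI)

lemma runs_Store: "0 < T \<Longrightarrow> Q r (m(r i := r j)) \<Longrightarrow> runs (Store i j) r m T Q"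
  unfolding runs_def using exec.Store[of i j r m] by (metis One_nat_def Suc_leI)

text \<open>With a \<open>runs\<close> statement as postcondition, programs are verified backwards
  as with weakest preconditions, and the time budgets add up.\<close>

lemma runs_Seq:
  assumes "runs c r m T (\<lambda>r' m'. runs d r' m' U Q)"
  shows "runs (Seq c d) r m (T + U) Q"
proof -
  obtain t r' m' where 1: "exec c (r, m) t (r', m')" "t \<le> T" "runs d r' m' U Q"
    using assms unfolding runs_def[of c] by blast
  obtain u r'' m'' where 2: "exec d (r', m') u (r'', m'')" "u \<le> U" "Q r'' m''"
    using 1(3) unfolding runs_def by blast
  show ?thesis
    unfolding runs_def using exec.Seq[OF 1(1) 2(1)] 1(2) 2(2,3) by (meson add_mono)
qed

lemma runs_SeqI:
  assumes "runs c r m T P" "\<And>r' m'. P r' m' \<Longrightarrow> runs d r' m' U Q" "T + U \<le> B"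
  shows "runs (Seq c d) r m B Q"
  using runs_Seq[OF runs_mono[OF assms(1) order_refl assms(2)]] assms(3) runs_mono by blast

lemma runs_IfNZ:
  assumes "r i \<noteq> 0 \<Longrightarrow> runs c r m T Q" "r i = 0 \<Longrightarrow> runs d r m U Q"
  shows "runs (IfNZ i c d) r m (1 + (T + U)) Q"
proof (cases "r i = 0")
  case True
  then obtain t r' m' where t: "exec d (r, m) t (r', m')" "t \<le> U" "Q r' m'"
    using assms(2) by (auto simp: runs_def)
  then have "1 + t \<le> 1 + (T + U)" by simp
  then show ?thesis
    unfolding runs_def using exec.IfFalse[of r i d m, OF True t(1)] t(3) by blast
next
  case False
  then obtain t r' m' where t: "exec c (r, m) t (r', m')" "t \<le> T" "Q r' m'"
    using assms(1) by (auto simp: runs_def)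
  then have "1 + t \<le> 1 + (T + U)" by simp
  then show ?thesis
    unfolding runs_def using exec.IfTrue[of r i c m, OF False t(1)] t(3) by blast
qed

text \<open>The index of \<open>J\<close> is both the termination measure and the bound on the
  number of rounds; it may drop by more than one. The outer 1 pays for the final, failing
  test.\<close>

lemma runs_WhileNZ:
  assumes "J k r m"
    and stop: "\<And>k r m. J k r m \<Longrightarrow> r i = 0 \<Longrightarrow> Q r m"
    and step: "\<And>k r m. J k r m \<Longrightarrow> r i \<noteq> 0 \<Longrightarrow> runs c r m T (\<lambda>r' m'. \<exists>l<k. J l r' m')"
  shows "runs (WhileNZ i c) r m (1 + k * (1 + T)) Q"
  using assms(1)
proof (induction k arbitrary: r m rule: less_induct)
  case (less k)
  show ?case
  proof (cases "r i = 0")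
    case True
    have "1 \<le> 1 + k * (1 + T)" by simp
    then show ?thesis
      unfolding runs_def
      using exec.WhileFalse[of r i c m, OF True] stop[OF less.prems True] by blast
  next
    case False
    then obtain t r' m' l where t: "exec c (r, m) t (r', m')" "t \<le> T" "l < k" "J l r' m'"
      using step[OF less.prems False] unfolding runs_def by blast
    then obtain u r'' m'' where u: "exec (WhileNZ i c) (r', m') u (r'', m'')"
        "u \<le> 1 + l * (1 + T)" "Q r'' m''"
      using less.IH[OF t(3,4)] unfolding runs_def by blast
    have "Suc l * (1 + T) \<le> k * (1 + T)"
      using t(3) by (intro mult_le_mono1) simp
    then have "1 + t + u \<le> 1 + k * (1 + T)"
      using t(2) u(2) by simp
    then show ?thesis
      unfolding runs_def using exec.WhileTrue[of r i c m, OF False t(1) u(1)] u(3) by blast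
  qed
qed

lemmas runs_intros = runs_Seq runs_Const runs_Add runs_Sub runs_Load runs_Store

text \<open>Register 0 has to contain the row length \<open>n\<close>.\<close>

definition address :: "nat \<Rightarrow> nat \<Rightarrow> nat \<Rightarrow> ram_program" where
  "address d i j =
     Seq (Const (d + 2) 0) (Seq (Add d j (d + 2)) (Seq (Add (d + 1) i (d + 2)) (Seq (Const (d + 2) 1)
       (WhileNZ (d + 1) (Seq (Add d d 0) (Sub (d + 1) (d + 1) (d + 2)))))))"

text \<open>Lacking multiplication, the machine builds the row offset by \<open>r i\<close>
  additions of register 0, hence the linear time. The bound \<open>r i \<le> n\<close> is not strict
  because row \<open>n\<close> holds the marks.\<close>

lemma runs_address:
  assumes "0 < d" "i < d" "j < d" "r i \<le> n" "r 0 = n"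
  shows "runs (address d i j) r m (5 + 3 * n)
    (\<lambda>r' m'. m' = m \<and> (\<forall>k<d. r' k = r k) \<and> r' d = r i * n + r j)"
proof -
  define J where "J k r' m' \<longleftrightarrow> m' = m \<and> (\<forall>k<d. r' k = r k) \<and> r' (d + 1) = k
    \<and> r' (d + 2) = 1 \<and> r' d + k * n = r i * n + r j" for k r' m'
  let ?r = "r(d + 2 := 0, d := r j, d + 1 := r i, d + 2 := 1)"
  let ?loop = "WhileNZ (d + 1) (Seq (Add d d 0) (Sub (d + 1) (d + 1) (d + 2)))"
  let ?Q = "\<lambda>r' m'. m' = m \<and> (\<forall>k<d. r' k = r k) \<and> r' d = r i * n + r j"
  have J: "J (r i) ?r m"
    by (simp add: J_def)
  have "runs ?loop ?r m (1 + r i * (1 + (1 + 1))) ?Q"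
  proof (rule runs_WhileNZ[where J = J, OF J])
    fix k r' m' assume "J k r' m'" "r' (d + 1) \<noteq> 0"
    then have "J (k - 1) (r'(d := r' d + r' 0, d + 1 := r' (d + 1) - r' (d + 2))) m'" "k - 1 < k"
      using assms by (cases k; auto simp: J_def)+
    then show "runs (Seq (Add d d 0) (Sub (d + 1) (d + 1) (d + 2))) r' m' (1 + 1)
        (\<lambda>r' m'. \<exists>l<k. J l r' m')"
      by (intro runs_intros) (auto simp del: One_nat_def)
  qed (auto simp: J_def)
  then have *: "runs ?loop ?r m (1 + 3 * n) ?Q"
    by (rule runs_mono) (use assms in auto)
  have "runs (address d i j) r m (1 + (1 + (1 + (1 + (1 + 3 * n))))) ?Q"
    unfolding address_def
    by (rule runs_Seq, rule runs_Const, simp, rule runs_Seq, rule runs_Add, simp,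
        rule runs_Seq, rule runs_Add, simp, rule runs_Seq, rule runs_Const, simp)
      (use * assms in simp)
  then show ?thesis
    by (rule runs_mono) auto
qed

text \<open>
  A query is a property of a graph on \<open>{..<n}\<close>, an assignment of vertices to variables and a set of
  marked vertices. The variables with indices \<open>1, \<dots>, d - 1\<close> are kept in the registers with the same
  indices; the registers from \<open>d\<close> on are scratch space and the answer is left in register \<open>d\<close>. The
  marks are stored as an additional row \<open>n\<close> of the adjacency matrix. With \<open>b\<close>, the marks may be read
  but not changed; without \<open>b\<close>, they are scratch space.
\<close>

type_synonym query = "nat \<Rightarrow> nat set set \<Rightarrow> (nat \<Rightarrow> nat) \<Rightarrow> nat set \<Rightarrow> bool"

definition holds_graph :: "nat \<Rightarrow> nat set set \<Rightarrow> (nat \<Rightarrow> nat) \<Rightarrow> bool" where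
  "holds_graph n E m \<longleftrightarrow> (\<forall>i<n. \<forall>j<n. m (i * n + j) \<noteq> 0 \<longleftrightarrow> {i, j} \<in> E)"

definition marked :: "nat \<Rightarrow> (nat \<Rightarrow> nat) \<Rightarrow> nat set" where
  "marked n m = {x. x < n \<and> m (n * n + x) \<noteq> 0}"

definition valuation :: "nat \<Rightarrow> nat \<Rightarrow> (nat \<Rightarrow> nat) \<Rightarrow> bool" where
  "valuation n d r \<longleftrightarrow> r 0 = n \<and> (\<forall>i. 0 < i \<longrightarrow> i < d \<longrightarrow> r i < n)"

text \<open>Subprograms leave arbitrary values in the registers from \<open>d\<close> on and, unless
  \<open>b\<close>, in the marks. Only a query independent of these keeps its truth value from one
  program state to the next.\<close>

definition local_query :: "bool \<Rightarrow> nat \<Rightarrow> query \<Rightarrow> bool" where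
  "local_query b d P \<longleftrightarrow> (\<forall>n E r r' L L'. (\<forall>i<d. r i = r' i) \<longrightarrow> (b \<longrightarrow> L = L')
     \<longrightarrow> P n E r L = P n E r' L')"

definition preserved :: "bool \<Rightarrow> nat \<Rightarrow> nat \<Rightarrow> nat set set \<Rightarrow> (nat \<Rightarrow> nat) \<Rightarrow> (nat \<Rightarrow> nat) \<Rightarrow>
    (nat \<Rightarrow> nat) \<Rightarrow> (nat \<Rightarrow> nat) \<Rightarrow> bool" where
  "preserved b d n E r m r' m' \<longleftrightarrow> (\<forall>i<d. r' i = r i) \<and> holds_graph n E m' \<and> (b \<longrightarrow> m' = m)"

definition answers :: "ram_program \<Rightarrow> nat poly \<Rightarrow> bool \<Rightarrow> nat \<Rightarrow> query \<Rightarrow> bool" where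
  "answers c p b d P \<longleftrightarrow> 0 < d \<and> local_query b d P \<and>
     (\<forall>n E r m. valuation n d r \<longrightarrow> holds_graph n E m \<longrightarrow>
       runs c r m (poly p n) (\<lambda>r' m'. preserved b d n E r m r' m'
         \<and> (r' d \<noteq> 0 \<longleftrightarrow> P n E r (marked n m))))"

definition poly_query :: "bool \<Rightarrow> nat \<Rightarrow> query \<Rightarrow> bool" where
  "poly_query b d P \<longleftrightarrow> (\<exists>c p. answers c p b d P)"

lemma poly_queryI:
  assumes "0 < d"
    and "\<And>n E r r' L L'. (\<And>i. i < d \<Longrightarrow> r i = r' i) \<Longrightarrow> (b \<Longrightarrow> L = L') \<Longrightarrow> P n E r L = P n E r' L'"
    and "\<And>n E r m. valuation n d r \<Longrightarrow> holds_graph n E m \<Longrightarrow>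
      runs c r m (poly p n) (\<lambda>r' m'. preserved b d n E r m r' m'
        \<and> (r' d \<noteq> 0 \<longleftrightarrow> P n E r (marked n m)))"
  shows "poly_query b d P"
  unfolding poly_query_def answers_def local_query_def
  by (intro exI[of _ c] exI[of _ p] conjI allI impI assms(1,3)) (rule assms(2); blast)+

lemma answersD:
  assumes "answers c p b d P" "valuation n d r" "holds_graph n E m"
  shows "runs c r m (poly p n) (\<lambda>r' m'. preserved b d n E r m r' m'
       \<and> (r' d \<noteq> 0 \<longleftrightarrow> P n E r (marked n m)))"
  using assms(2,3) assms(1)[unfolded answers_def, THEN conjunct2, THEN conjunct2] by simp

lemma answers_pos: "answers c p b d P \<Longrightarrow> 0 < d"
  unfolding answers_def by blast

lemma answers_local:
  assumes "answers c p b d P" "\<And>i. i < d \<Longrightarrow> r i = r' i" "b \<Longrightarrow> L = L'"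
  shows "P n E r L = P n E r' L'"
  using assms(2,3) assms(1)[unfolded answers_def local_query_def, THEN conjunct2, THEN conjunct1]
  by simp

lemma valuation_preserved:
  "preserved b d n E r m r' m' \<Longrightarrow> valuation n d r \<Longrightarrow> 0 < d \<Longrightarrow> valuation n d r'"
  unfolding valuation_def preserved_def by simp

section \<open>Atomic queries, connectives and quantifiers\<close>

definition edge_q :: "nat \<Rightarrow> nat \<Rightarrow> query" where
  "edge_q i j = (\<lambda>n E r L. {r i, r j} \<in> E)"

definition neq_q :: "nat \<Rightarrow> nat \<Rightarrow> query" where
  "neq_q i j = (\<lambda>n E r L. r i \<noteq> r j)"

definition mark_q :: "nat \<Rightarrow> query" where
  "mark_q i = (\<lambda>n E r L. r i \<in> L)"

definition not_q :: "query \<Rightarrow> query" where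
  "not_q P = (\<lambda>n E r L. \<not> P n E r L)"

definition and_q :: "query \<Rightarrow> query \<Rightarrow> query" where
  "and_q P Q = (\<lambda>n E r L. P n E r L \<and> Q n E r L)"

definition ex_q :: "nat \<Rightarrow> query \<Rightarrow> query" where
  "ex_q d P = (\<lambda>n E r L. \<exists>x<n. P n E (r(d := x)) L)"

text \<open>For evaluation the fixed point is stored in the row of marks, where \<open>P\<close> and
  \<open>Q\<close> read it. There is only one such row, so the resulting query treats the marks as
  scratch space, and fixed points are not nested.\<close>

definition lfp_q :: "nat \<Rightarrow> query \<Rightarrow> query \<Rightarrow> query" where
  "lfp_q d P Q = (\<lambda>n E r L. Q n E r (lfp (\<lambda>X. {x. x < n \<and> P n E (r(d := x)) X})))"

lemma poly_query_edge:
  assumes "0 < i" "0 < j" "i < d" "j < d"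
  shows "poly_query b d (edge_q i j)"
proof (rule poly_queryI)
  fix n E r m assume v: "valuation n d r" and g: "holds_graph n E m"
  have *: "0 < d" "r i \<le> n" "r 0 = n" using v assms by (auto simp: valuation_def less_imp_le)
  show "runs (Seq (address d i j) (Load d d)) r m (poly [:6, 3:] n)
     (\<lambda>r' m'. preserved b d n E r m r' m' \<and> (r' d \<noteq> 0 \<longleftrightarrow> edge_q i j n E r (marked n m)))"
    by (rule runs_SeqI[OF runs_address[of d i j r n, OF *(1) assms(3,4) *(2,3)], where U = 1], rule runs_Load)
      (use v g assms in \<open>auto simp: valuation_def holds_graph_def edge_q_def preserved_def\<close>)
qed (use assms in \<open>auto simp: edge_q_def\<close>)

lemma poly_query_mark:
  assumes "0 < i" "i < d"
  shows "poly_query True d (mark_q i)"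
proof (rule poly_queryI)
  fix n E r m assume v: "valuation n d r" and g: "holds_graph n E m"
  have *: "0 < d" "r 0 \<le> n" "r 0 = n" using v assms by (auto simp: valuation_def)
  \<comment> \<open>Register 0 contains \<open>n\<close>, so as a row index it selects the row of
    marks.\<close>
  show "runs (Seq (address d 0 i) (Load d d)) r m (poly [:6, 3:] n)
     (\<lambda>r' m'. preserved True d n E r m r' m' \<and> (r' d \<noteq> 0 \<longleftrightarrow> mark_q i n E r (marked n m)))"
    by (rule runs_SeqI[OF runs_address[of d 0 i r n, OF *(1) *(1) assms(2) *(2,3)], where U = 1], rule runs_Load)
      (use v g assms in \<open>auto simp: valuation_def marked_def mark_q_def preserved_def\<close>)
qed (use assms in \<open>auto simp: mark_q_def\<close>)

lemma poly_query_neq: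
  assumes "i < d" "j < d"
  shows "poly_query b d (neq_q i j)"
proof (rule poly_queryI)
  fix n E r m assume g: "holds_graph n E m"
  \<comment> \<open>As subtraction is truncated, both differences are 0 only for equal
    values.\<close>
  have "runs (Seq (Sub d i j) (Seq (Sub (d + 1) j i) (Add d d (d + 1)))) r m (1 + (1 + 1))
     (\<lambda>r' m'. preserved b d n E r m r' m' \<and> (r' d \<noteq> 0 \<longleftrightarrow> neq_q i j n E r (marked n m)))"
    by (intro runs_intros) (use g assms in \<open>auto simp: neq_q_def preserved_def\<close>)
  then show "runs (Seq (Sub d i j) (Seq (Sub (d + 1) j i) (Add d d (d + 1)))) r m (poly [:3:] n)
     (\<lambda>r' m'. preserved b d n E r m r' m' \<and> (r' d \<noteq> 0 \<longleftrightarrow> neq_q i j n E r (marked n m)))"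
    by (rule runs_mono) auto
qed (use assms in \<open>auto simp: neq_q_def\<close>)

lemma poly_query_not:
  assumes "poly_query b d P"
  shows "poly_query b d (not_q P)"
proof -
  obtain c p where c: "answers c p b d P"
    using assms unfolding poly_query_def by blast
  show ?thesis
  proof (rule poly_queryI)
    fix n E r m assume v: "valuation n d r" and g: "holds_graph n E m"
    show "runs (Seq c (Seq (Const (d + 1) 1) (Sub d (d + 1) d))) r m (poly (p + [:2:]) n)
       (\<lambda>r' m'. preserved b d n E r m r' m' \<and> (r' d \<noteq> 0 \<longleftrightarrow> not_q P n E r (marked n m)))"
      by (rule runs_SeqI[OF answersD[OF c v g], where U = "1 + 1"], intro runs_intros)
        (auto simp: not_q_def preserved_def)
  next
    fix n E and r r' :: "nat \<Rightarrow> nat" and L L' :: "nat set"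
    assume "\<And>i. i < d \<Longrightarrow> r i = r' i" "b \<Longrightarrow> L = L'"
    then show "not_q P n E r L = not_q P n E r' L'"
      using answers_local[OF c, of r r' L L'] by (simp add: not_q_def)
  qed (rule answers_pos[OF c])
qed

lemma poly_query_and:
  assumes "poly_query b d P" "poly_query b d Q"
  shows "poly_query b d (and_q P Q)"
proof -
  obtain c p where c: "answers c p b d P"
    using assms unfolding poly_query_def by blast
  obtain e q where e: "answers e q b d Q"
    using assms unfolding poly_query_def by blast
  show ?thesis
  proof (rule poly_queryI)
    fix n E r m assume v: "valuation n d r" and g: "holds_graph n E m"
    let ?Q = "\<lambda>r' m'. preserved b d n E r m r' m' \<and> (r' d \<noteq> 0 \<longleftrightarrow> and_q P Q n E r (marked n m))"
    \<comment> \<open>A false first conjunct has already left 0 in register \<open>d\<close>; the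
      second branch is a dummy instruction.\<close>
    show "runs (Seq c (IfNZ d e (Const (d + 1) 0))) r m (poly (p + q + [:2:]) n) ?Q"
    proof (rule runs_SeqI[OF answersD[OF c v g], where U = "1 + (poly q n + 1)"])
      fix r' m'
      assume s: "preserved b d n E r m r' m' \<and> (r' d \<noteq> 0 \<longleftrightarrow> P n E r (marked n m))"
      then have v': "valuation n d r'" and g': "holds_graph n E m'"
        using valuation_preserved[of b d n E r m r' m'] v answers_pos[OF c]
        by (simp_all add: preserved_def)
      have "Q n E r' (marked n m') = Q n E r (marked n m)"
        using s by (intro answers_local[OF e]) (auto simp: preserved_def)
      then have "runs e r' m' (poly q n) ?Q" if "r' d \<noteq> 0"
        by (rule_tac runs_mono[OF answersD[OF e v' g']])
          (use s that in \<open>auto simp: and_q_def preserved_def\<close>)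
      then show "runs (IfNZ d e (Const (d + 1) 0)) r' m' (1 + (poly q n + 1)) ?Q"
        by (rule runs_IfNZ, simp, intro runs_Const) (use s in \<open>auto simp: and_q_def preserved_def\<close>)
    qed simp
  next
    fix n E and r r' :: "nat \<Rightarrow> nat" and L L' :: "nat set"
    assume "\<And>i. i < d \<Longrightarrow> r i = r' i" "b \<Longrightarrow> L = L'"
    then show "and_q P Q n E r L = and_q P Q n E r' L'"
      using answers_local[OF c, of r r' L L'] answers_local[OF e, of r r' L L']
      by (simp add: and_q_def)
  qed (rule answers_pos[OF c])
qed

text \<open>On success, the flag in register \<open>d + 1\<close> is nonzero and register \<open>d\<close> contains the vertex found.\<close>

definition search :: "nat \<Rightarrow> ram_program \<Rightarrow> ram_program" where
  "search d c =
     Seq (Const (d + 1) 0) (Seq (Add d 0 (d + 1)) (Seq (Add (d + 2) 0 (d + 1))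
       (WhileNZ (d + 2)
         (Seq (Const (d + 3) 1) (Seq (Sub d d (d + 3)) (Seq c
           (IfNZ (d + 1) (Const (d + 2) 0) (Seq (Const (d + 3) 0) (Add (d + 2) d (d + 3))))))))))"

lemma runs_search:
  assumes c: "answers c p b (Suc d) P" and d: "0 < d"
    and v: "valuation n d r" and g: "holds_graph n E m"
  shows "runs (search d c) r m (4 + n * (7 + poly p n)) (\<lambda>r' m'. preserved b d n E r m r' m' \<and>
    (if r' (d + 1) = 0 then \<forall>x<n. \<not> P n E (r(d := x)) (marked n m)
     else r' d < n \<and> P n E (r(d := r' d)) (marked n m)))"
proof -
  \<comment> \<open>Either all candidates from \<open>k\<close> on are refuted, or one is found and
    the loop register \<open>d + 2\<close> is 0. That register is separate from \<open>d\<close>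
    because the search must stop with the vertex found still in \<open>d\<close>. It is set again
    after each call of \<open>c\<close>, which may overwrite all registers above
    \<open>d\<close>.\<close>
  define J where "J k r' m' \<longleftrightarrow> preserved b d n E r m r' m' \<and>
    (r' (d + 1) = 0 \<and> r' (d + 2) = k \<and> r' d = k \<and> k \<le> n
       \<and> (\<forall>x<n. k \<le> x \<longrightarrow> \<not> P n E (r(d := x)) (marked n m))
     \<or> r' (d + 1) \<noteq> 0 \<and> r' (d + 2) = 0 \<and> r' d < n \<and> P n E (r(d := r' d)) (marked n m))"
    for k r' m'
  let ?Q = "\<lambda>r' m'. preserved b d n E r m r' m' \<and>
    (if r' (d + 1) = 0 then \<forall>x<n. \<not> P n E (r(d := x)) (marked n m)
     else r' d < n \<and> P n E (r(d := r' d)) (marked n m))"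
  let ?test = "IfNZ (d + 1) (Const (d + 2) 0) (Seq (Const (d + 3) 0) (Add (d + 2) d (d + 3)))"
  let ?body = "Seq (Const (d + 3) 1) (Seq (Sub d d (d + 3)) (Seq c ?test))"
  have J: "J n (r(d + 1 := 0, d := n, d + 2 := n)) m"
    using g by (auto simp: J_def preserved_def)
  have "runs (WhileNZ (d + 2) ?body) (r(d + 1 := 0, d := n, d + 2 := n)) m
      (1 + n * (1 + (1 + (1 + (poly p n + 4))))) ?Q"
  proof (rule runs_WhileNZ[where J = J, OF J])
    fix k r' m' assume "J k r' m'" "r' (d + 2) = 0"
    then show "?Q r' m'" by (auto simp: J_def)
  next
    fix k r' m' assume J: "J k r' m'" and k: "r' (d + 2) \<noteq> 0"
    then have r': "preserved b d n E r m r' m'" "r' (d + 1) = 0" "r' d = k" "0 < k" "k \<le> n"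
      and none: "\<And>x. x < n \<Longrightarrow> k \<le> x \<Longrightarrow> \<not> P n E (r(d := x)) (marked n m)"
      by (auto simp: J_def)
    let ?r = "r'(d + 3 := 1, d := k - 1)"
    have v': "valuation n (Suc d) ?r" and g': "holds_graph n E m'"
      using r' v d by (auto simp: valuation_def preserved_def less_Suc_eq)
    have P: "P n E ?r (marked n m') = P n E (r(d := k - 1)) (marked n m)"
      using r' by (intro answers_local[OF c]) (auto simp: preserved_def less_Suc_eq)
    have "runs (Seq c ?test) ?r m' (poly p n + 4) (\<lambda>r' m'. \<exists>l<k. J l r' m')"
    proof (rule runs_SeqI[OF answersD[OF c v' g'], where U = "1 + (1 + (1 + 1))"])
      fix r'' m''
      assume r'': "preserved b (Suc d) n E ?r m' r'' m''
        \<and> (r'' (Suc d) \<noteq> 0 \<longleftrightarrow> P n E ?r (marked n m'))"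
      have pres: "preserved b d n E r m r'' m''" "r'' d = k - 1"
        using r' r'' by (auto simp: preserved_def)
      have "J (k - 1) (r''(d + 2 := 0)) m''" if "r'' (d + 1) \<noteq> 0"
        using that r'' pres P r'(4,5) by (auto simp: J_def preserved_def)
      moreover have "J (k - 1) (r''(d + 3 := 0, d + 2 := r'' d)) m''" if "r'' (d + 1) = 0"
      proof -
        have "\<not> P n E (r(d := x)) (marked n m)" if "x < n" "k - 1 \<le> x" for x
          using none[of x] that r'' P \<open>r'' (d + 1) = 0\<close> by (cases "x = k - 1") auto
        then show ?thesis
          using that pres r'(4,5) by (auto simp: J_def preserved_def)
      qed
      ultimately show "runs ?test r'' m'' (1 + (1 + (1 + 1))) (\<lambda>r' m'. \<exists>l<k. J l r' m')"
        using diff_less[OF zero_less_one r'(4)]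
        by (rule_tac runs_IfNZ; (rule_tac runs_Const | rule_tac runs_Seq, rule_tac runs_Const,
            simp, rule_tac runs_Add); auto simp del: One_nat_def add_2_eq_Suc')
    qed simp
    then show "runs ?body r' m' (1 + (1 + (poly p n + 4))) (\<lambda>r' m'. \<exists>l<k. J l r' m')"
      by (rule_tac runs_Seq, rule_tac runs_Const, simp, rule_tac runs_Seq, rule_tac runs_Sub, simp)
        (use r' in simp)
  qed
  then have "runs (search d c) r m (1 + (1 + (1 + (1 + n * (1 + (1 + (1 + (poly p n + 4)))))))) ?Q"
    unfolding search_def
    by (rule_tac runs_Seq, rule_tac runs_Const, simp, rule_tac runs_Seq, rule_tac runs_Add, simp,
        rule_tac runs_Seq, rule_tac runs_Add, simp) (use v d in \<open>simp add: valuation_def fun_upd_twist\<close>)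
  then show ?thesis
    by (rule runs_mono) auto
qed

lemma poly_query_ex:
  assumes "poly_query b (Suc d) P" and d: "0 < d"
  shows "poly_query b d (ex_q d P)"
proof -
  obtain c p where c: "answers c p b (Suc d) P"
    using assms unfolding poly_query_def by blast
  show ?thesis
  proof (rule poly_queryI)
    fix n E r m assume v: "valuation n d r" and g: "holds_graph n E m"
    \<comment> \<open>The answer is the flag and not the vertex found, which may be vertex
      0.\<close>
    show "runs (Seq (search d c) (Seq (Const (d + 2) 0) (Add d (d + 1) (d + 2)))) r m
       (poly ([:6:] + [:0, 1:] * ([:7:] + p)) n)
       (\<lambda>r' m'. preserved b d n E r m r' m' \<and> (r' d \<noteq> 0 \<longleftrightarrow> ex_q d P n E r (marked n m)))"
      by (rule runs_SeqI[OF runs_search[OF c d v g], where U = "1 + 1"], intro runs_intros)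
        (auto simp: ex_q_def preserved_def split: if_splits)
  next
    fix n E and r r' :: "nat \<Rightarrow> nat" and L L' :: "nat set"
    assume "\<And>i. i < d \<Longrightarrow> r i = r' i" "b \<Longrightarrow> L = L'"
    then have "P n E (r(d := x)) L = P n E (r'(d := x)) L'" for x
      by (intro answers_local[OF c]) auto
    then show "ex_q d P n E r L = ex_q d P n E r' L'"
      by (simp add: ex_q_def)
  qed (rule d)
qed

text \<open>Sets the mark of some vertex satisfying the query to \<open>v\<close> as long as there is such a vertex.\<close>

definition saturate :: "nat \<Rightarrow> nat \<Rightarrow> ram_program \<Rightarrow> ram_program" where
  "saturate d v c = Seq (search d c) (WhileNZ (d + 1)
     (Seq (address (d + 2) 0 d) (Seq (Const (d + 3) v) (Seq (Store (d + 2) (d + 3)) (search d c)))))"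

section \<open>Least fixed points by marking vertices one at a time\<close>

lemma matrix_index_less: "i < n \<Longrightarrow> j < n \<Longrightarrow> i * n + j < n * (n::nat)"
  using mult_le_mono1[of "Suc i" n n] by simp

text \<open>The cells of the matrix have addresses below \<open>n * n\<close>, those of the marks
  from \<open>n * n\<close> on.\<close>

lemma holds_graph_mark: "holds_graph n E m \<Longrightarrow> holds_graph n E (m(n * n + x := v))"
  unfolding holds_graph_def
  by (metis fun_upd_other matrix_index_less not_add_less1)

text \<open>The invariant \<open>J\<close> and the measure \<open>\<mu>\<close> are left open so
  that the same lemma serves to clear all marks (\<open>v = 0\<close>) and to enlarge the marked set
  (\<open>v = 1\<close>). The measure starts at \<open>n\<close> or below, which limits the loop to
  \<open>n\<close> rounds.\<close>

lemma runs_saturate: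
  fixes J :: "nat set \<Rightarrow> bool" and \<mu> :: "nat set \<Rightarrow> nat" and v :: nat
  defines "upd \<equiv> (\<lambda>x L. if v = 0 then L - {x} else insert x L)"
  assumes c: "answers c p True (Suc d) P" and d: "0 < d"
    and val: "valuation n d r" and g: "holds_graph n E m"
    and init: "J (marked n m)" "\<mu> (marked n m) \<le> n"
    and step: "\<And>x L. J L \<Longrightarrow> x < n \<Longrightarrow> L \<subseteq> {..<n} \<Longrightarrow> P n E (r(d := x)) L \<Longrightarrow>
      J (upd x L) \<and> \<mu> (upd x L) < \<mu> L"
  shows "runs (saturate d v c) r m (5 + n * (7 + poly p n) + n * (13 + 3 * n + n * (7 + poly p n)))
    (\<lambda>r' m'. preserved False d n E r m r' m' \<and> J (marked n m')
      \<and> (\<forall>x<n. \<not> P n E (r(d := x)) (marked n m')))"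
proof -
  let ?S = "4 + n * (7 + poly p n)"
  \<comment> \<open>Each round ends with a new search, so the outcome of the latest search for the
    current marks belongs to the invariant.\<close>
  define K where "K k r' m' \<longleftrightarrow> preserved False d n E r m r' m' \<and> J (marked n m') \<and> \<mu> (marked n m') = k
    \<and> (if r' (d + 1) = 0 then \<forall>x<n. \<not> P n E (r(d := x)) (marked n m')
       else r' d < n \<and> P n E (r(d := r' d)) (marked n m'))" for k r' m'
  let ?Q = "\<lambda>r' m'. preserved False d n E r m r' m' \<and> J (marked n m')
      \<and> (\<forall>x<n. \<not> P n E (r(d := x)) (marked n m'))"
  let ?body = "Seq (address (d + 2) 0 d) (Seq (Const (d + 3) v)
    (Seq (Store (d + 2) (d + 3)) (search d c)))"
  have marked_mark: "marked n (m(n * n + x := v)) = upd x (marked n m)" if "x < n" for m x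
    using that by (auto simp: marked_def upd_def)
  have body: "runs ?body r' m' (8 + 3 * n + ?S) (\<lambda>r' m'. \<exists>l<k. K l r' m')"
    if K: "K k r' m'" and nz: "r' (d + 1) \<noteq> 0" for k r' m'
  proof -
    have r': "preserved False d n E r m r' m'" "J (marked n m')" "\<mu> (marked n m') = k"
        "r' d < n" "P n E (r(d := r' d)) (marked n m')"
      using K nz by (auto simp: K_def)
    have r'0: "r' 0 = n" using r' val d by (auto simp: preserved_def valuation_def)
    let ?m = "m'(n * n + r' d := v)"
    have dec: "J (marked n ?m)" "\<mu> (marked n ?m) < k"
      using step[OF r'(2,4) _ r'(5)] r'(3) marked_mark[OF r'(4)] by (auto simp: marked_def)
    show ?thesis
    proof (rule runs_SeqI[OF runs_address[of "d + 2" 0 d r' n], where U = "1 + (1 + ?S)"])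
      fix r1 m1 assume r1: "m1 = m' \<and> (\<forall>k<d + 2. r1 k = r' k) \<and> r1 (d + 2) = r' 0 * n + r' d"
      let ?r = "r1(d + 3 := v)"
      have vr: "valuation n d ?r" and gm: "holds_graph n E ?m"
        using r1 r' val d by (auto simp: preserved_def valuation_def intro: holds_graph_mark)
      have P: "P n E (?r(d := x)) (marked n ?m) = P n E (r(d := x)) (marked n ?m)" for x
        using r1 r' by (intro answers_local[OF c]) (auto simp: preserved_def less_Suc_eq)
      have "runs (search d c) ?r ?m ?S (\<lambda>r' m'. \<exists>l<k. K l r' m')"
        by (rule runs_mono[OF runs_search[OF c d vr gm] order_refl], unfold P)
          (use r1 r' dec in \<open>auto simp: K_def preserved_def\<close>)
      then show "runs (Seq (Const (d + 3) v) (Seq (Store (d + 2) (d + 3)) (search d c))) r1 m1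
          (1 + (1 + ?S)) (\<lambda>r' m'. \<exists>l<k. K l r' m')"
        by (rule_tac runs_Seq, rule_tac runs_Const, simp, rule_tac runs_Seq, rule_tac runs_Store, simp)
          (use r1 r'0 in simp)
    qed (use r'0 in auto)
  qed
  show ?thesis
    unfolding saturate_def
  proof (rule runs_SeqI[OF runs_search[OF c d val g],
        where U = "1 + n * (1 + (8 + 3 * n + ?S))"])
    fix r' m' assume r': "preserved True d n E r m r' m' \<and>
      (if r' (d + 1) = 0 then \<forall>x<n. \<not> P n E (r(d := x)) (marked n m)
       else r' d < n \<and> P n E (r(d := r' d)) (marked n m))"
    then have K: "K (\<mu> (marked n m)) r' m'"
      using init g by (auto simp: K_def preserved_def)
    have "runs (WhileNZ (d + 1) ?body) r' m' (1 + \<mu> (marked n m) * (1 + (8 + 3 * n + ?S))) ?Q"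
      by (rule runs_WhileNZ[where J = K, OF K _ body]) (auto simp: K_def)
    then show "runs (WhileNZ (d + 1) ?body) r' m' (1 + n * (1 + (8 + 3 * n + ?S))) ?Q"
      by (rule runs_mono) (use init(2) in \<open>auto intro: mult_le_mono1\<close>)
  qed (simp add: algebra_simps)
qed

text \<open>By monotonicity, adding single elements in any order stays below the least fixed point.
  When nothing can be added, the marked set is closed under the operator and therefore contains the
  least fixed point.\<close>

lemma poly_query_lfp:
  assumes "poly_query True (Suc d) P" "poly_query True d Q" "0 < d"
    and mono: "\<And>n E r X Y. X \<subseteq> Y \<Longrightarrow> P n E r X \<Longrightarrow> P n E r Y"
  shows "poly_query False d (lfp_q d P Q)"
proof -
  have d: "0 < d" by fact
  obtain c0 p0 where c0: "answers c0 p0 True (Suc d) (mark_q d)"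
    using poly_query_mark[of d "Suc d"] d unfolding poly_query_def by blast
  \<comment> \<open>Only unmarked vertices are offered, so every round enlarges the marked
    set.\<close>
  obtain c p where c: "answers c p True (Suc d) (and_q (not_q (mark_q d)) P)"
    using poly_query_and[OF poly_query_not[OF poly_query_mark[of d "Suc d"]] assms(1)] d
    unfolding poly_query_def by blast
  obtain c' p' where c': "answers c' p' True (Suc d) P"
    using assms(1) unfolding poly_query_def by blast
  obtain e q where e: "answers e q True d Q"
    using assms(2) unfolding poly_query_def by blast
  let ?prog = "Seq (saturate d 0 c0) (Seq (saturate d 1 c) e)"
  define T where "T p = [:5:] + [:0, 1:] * ([:7:] + p) + [:0, 1:] * ([:13, 3:] + [:0, 1:] * ([:7:] + p))"
    for p :: "nat poly"
  have T: "poly (T p) n = 5 + n * (7 + poly p n) + n * (13 + 3 * n + n * (7 + poly p n))" for p n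
    by (simp add: T_def algebra_simps)
  show ?thesis
  proof (rule poly_queryI)
    fix n E r m assume v: "valuation n d r" and g: "holds_graph n E m"
    define F where "F X = {x. x < n \<and> P n E (r(d := x)) X}" for X
    have "mono F" unfolding F_def using mono by (auto intro!: monoI)
    have bounded: "marked n m \<subseteq> {..<n}" for m by (auto simp: marked_def)
    let ?Q = "\<lambda>r' m'. preserved False d n E r m r' m' \<and> (r' d \<noteq> 0 \<longleftrightarrow> lfp_q d P Q n E r (marked n m))"
    \<comment> \<open>The marks may be leftovers of an earlier evaluation. Searching for marked
      vertices with \<open>v = 0\<close> clears them.\<close>
    have "runs (saturate d 0 c0) r m (poly (T p0) n)
        (\<lambda>r' m'. preserved False d n E r m r' m' \<and> True
          \<and> (\<forall>x<n. \<not> mark_q d n E (r(d := x)) (marked n m')))"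
      unfolding T
    proof (rule runs_saturate[OF c0 d v g, where \<mu> = card])
      fix x L assume "L \<subseteq> {..<n}" "mark_q d n E (r(d := x)) L"
      then have "finite L" "x \<in> L" by (auto simp: mark_q_def intro: finite_subset)
      then have "card (L - {x}) < card L" by (rule card_Diff1_less)
      then show "True \<and> card (if 0 = (0::nat) then L - {x} else insert x L) < card L" by simp
    qed (use card_mono[OF _ bounded[of m]] in auto)
    then show "runs ?prog r m (poly (T p0 + (T p + q)) n) ?Q"
    proof (rule runs_SeqI[where U = "poly (T p + q) n"])
      fix r1 m1
      assume *: "preserved False d n E r m r1 m1 \<and> True
        \<and> (\<forall>x<n. \<not> mark_q d n E (r(d := x)) (marked n m1))"
      then have v1: "valuation n d r1" and g1: "holds_graph n E m1"
        using valuation_preserved[of False d n E r m r1 m1] v d by (simp_all add: preserved_def)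
      have empty: "marked n m1 = {}"
        using * by (auto simp: mark_q_def marked_def)
      have eq: "P n E (r1(d := x)) X = P n E (r(d := x)) X" for x X
        using * by (intro answers_local[OF c']) (auto simp: preserved_def less_Suc_eq)
      have "runs (saturate d 1 c) r1 m1 (poly (T p) n)
        (\<lambda>r' m'. preserved False d n E r1 m1 r' m' \<and> marked n m' \<subseteq> lfp F
          \<and> (\<forall>x<n. \<not> and_q (not_q (mark_q d)) P n E (r1(d := x)) (marked n m')))"
        unfolding T
      proof (rule runs_saturate[OF c d v1 g1, where J = "\<lambda>L. L \<subseteq> lfp F" and \<mu> = "\<lambda>L. n - card L"])
        fix x L assume L: "L \<subseteq> lfp F" "x < n" "L \<subseteq> {..<n}"
          and P: "and_q (not_q (mark_q d)) P n E (r1(d := x)) L"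
        have x: "x \<notin> L" "P n E (r(d := x)) L" using P eq by (auto simp: and_q_def not_q_def mark_q_def)
        then have "x \<in> F (lfp F)" using mono L by (auto simp: F_def)
        then have "x \<in> lfp F" using lfp_fixpoint[OF \<open>mono F\<close>] by simp
        moreover have "n - card (insert x L) < n - card L"
        proof -
          have "finite L" using L finite_subset by blast
          then have "card L < card (insert x L)" using x by simp
          moreover have "card (insert x L) \<le> n" using card_mono[of "{..<n}" "insert x L"] L by simp
          ultimately show ?thesis by linarith
        qed
        ultimately show "(if 1 = (0::nat) then L - {x} else insert x L) \<subseteq> lfp F \<and>
            n - card (if 1 = (0::nat) then L - {x} else insert x L) < n - card L"
          using L by simp
      qed (auto simp: empty)
      then show "runs (Seq (saturate d 1 c) e) r1 m1 (poly (T p + q) n) ?Q"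
      proof (rule runs_SeqI[where U = "poly q n"])
        fix r2 m2
        assume **: "preserved False d n E r1 m1 r2 m2 \<and> marked n m2 \<subseteq> lfp F
          \<and> (\<forall>x<n. \<not> and_q (not_q (mark_q d)) P n E (r1(d := x)) (marked n m2))"
        then have v2: "valuation n d r2" and g2: "holds_graph n E m2"
          using valuation_preserved[of False d n E r1 m1 r2 m2] v1 d by (simp_all add: preserved_def)
        have "F (marked n m2) \<subseteq> marked n m2"
          using ** eq by (auto simp: F_def and_q_def not_q_def mark_q_def)
        then have "marked n m2 = lfp F"
          using ** lfp_lowerbound by blast
        moreover have "Q n E r2 X = Q n E r X" for X
          using * ** by (intro answers_local[OF e]) (auto simp: preserved_def)
        ultimately show "runs e r2 m2 (poly q n) ?Q"
          by (rule_tac runs_mono[OF answersD[OF e v2 g2]])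
            (use * ** in \<open>auto simp: preserved_def lfp_q_def F_def[abs_def]\<close>)
      qed simp
    qed simp
  next
    fix n E and r r' :: "nat \<Rightarrow> nat" and L L' :: "nat set"
    assume r: "\<And>i. i < d \<Longrightarrow> r i = r' i"
    have "P n E (r(d := x)) X = P n E (r'(d := x)) X" for x X
      using r by (intro answers_local[OF c']) auto
    moreover have "Q n E r X = Q n E r' X" for X
      using r by (intro answers_local[OF e]) auto
    ultimately show "lfp_q d P Q n E r L = lfp_q d P Q n E r' L'"
      by (simp add: lfp_q_def)
  qed (rule d)
qed

lemma poly_time_decidable_if_poly_query:
  assumes "poly_query False 1 P"
    and "\<And>n E r L. simple_graph {..<n} E \<Longrightarrow> R {..<n} E \<Longrightarrow> P n E r L \<longleftrightarrow> Q {..<n} E"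
  shows "poly_time_decidable R Q"
proof -
  obtain c p where c: "answers c p False 1 P"
    using assms(1) unfolding poly_query_def by blast
  show ?thesis
    unfolding poly_time_decidable_def
  \<comment> \<open>Acceptance is read off register 0, whereas the query leaves its answer in
    register 1.\<close>
  proof (intro exI[of _ "Seq c (Seq (Const 2 0) (Add 0 1 2))"] exI[of _ "p + [:2:]"] allI impI)
    fix n E assume G: "simple_graph {..<n} E" "R {..<n} E"
    obtain r m where rm: "graph_input n E = (r, m)" by (cases "graph_input n E")
    then have r: "valuation n 1 r" and m: "holds_graph n E m"
      by (auto simp: graph_input_def valuation_def holds_graph_def matrix_index_less split: if_splits)
    have "runs (Seq c (Seq (Const 2 0) (Add 0 1 2))) r m (poly (p + [:2:]) n)
        (\<lambda>r' m'. r' 0 \<noteq> 0 \<longleftrightarrow> Q {..<n} E)"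
      by (rule runs_SeqI[OF answersD[OF c r m], where U = "1 + 1"], intro runs_intros)
        (auto simp: assms(2)[OF G])
    then show "\<exists>t s. exec (Seq c (Seq (Const 2 0) (Add 0 1 2))) (graph_input n E) t s
        \<and> t \<le> poly (p + [:2:]) n \<and> (accepting s \<longleftrightarrow> Q {..<n} E)"
      unfolding rm runs_def accepting_def by fastforce
  qed
qed

section \<open>Derived connectives\<close>

definition eq_q :: "nat \<Rightarrow> nat \<Rightarrow> query" where
  "eq_q i j = (\<lambda>n E r L. r i = r j)"

definition or_q :: "query \<Rightarrow> query \<Rightarrow> query" where
  "or_q P Q = (\<lambda>n E r L. P n E r L \<or> Q n E r L)"

definition imp_q :: "query \<Rightarrow> query \<Rightarrow> query" where
  "imp_q P Q = (\<lambda>n E r L. P n E r L \<longrightarrow> Q n E r L)"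

definition iff_q :: "query \<Rightarrow> query \<Rightarrow> query" where
  "iff_q P Q = (\<lambda>n E r L. P n E r L \<longleftrightarrow> Q n E r L)"

definition all_q :: "nat \<Rightarrow> query \<Rightarrow> query" where
  "all_q d P = (\<lambda>n E r L. \<forall>x<n. P n E (r(d := x)) L)"

lemma poly_query_eq:
  assumes "i < d" "j < d"
  shows "poly_query b d (eq_q i j)"
proof -
  have "eq_q i j = not_q (neq_q i j)"
    by (simp add: eq_q_def not_q_def neq_q_def)
  then show ?thesis using assms by (simp add: poly_query_not poly_query_neq)
qed

lemma poly_query_or:
  assumes "poly_query b d P" "poly_query b d Q"
  shows "poly_query b d (or_q P Q)"
proof -
  have "or_q P Q = not_q (and_q (not_q P) (not_q Q))"
    by (simp add: or_q_def not_q_def and_q_def)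
  then show ?thesis using assms by (simp add: poly_query_not poly_query_and)
qed

lemma poly_query_imp:
  assumes "poly_query b d P" "poly_query b d Q"
  shows "poly_query b d (imp_q P Q)"
proof -
  have "imp_q P Q = not_q (and_q P (not_q Q))"
    by (simp add: imp_q_def not_q_def and_q_def)
  then show ?thesis using assms by (simp add: poly_query_not poly_query_and)
qed

lemma poly_query_iff:
  assumes "poly_query b d P" "poly_query b d Q"
  shows "poly_query b d (iff_q P Q)"
proof -
  have "iff_q P Q = and_q (imp_q P Q) (imp_q Q P)"
    unfolding iff_q_def imp_q_def and_q_def by (intro ext) blast
  then show ?thesis using assms by (simp add: poly_query_and poly_query_imp)
qed

lemma poly_query_all:
  assumes "poly_query b (Suc d) P" "0 < d"
  shows "poly_query b d (all_q d P)"
proof -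
  have "all_q d P = not_q (ex_q d (not_q P))"
    by (simp add: all_q_def not_q_def ex_q_def)
  then show ?thesis using assms by (simp add: poly_query_not poly_query_ex)
qed

lemmas query_simps = edge_q_def neq_q_def mark_q_def not_q_def and_q_def ex_q_def eq_q_def or_q_def
  imp_q_def iff_q_def all_q_def

lemmas poly_query_intros = poly_query_edge poly_query_neq poly_query_mark poly_query_not
  poly_query_and poly_query_ex poly_query_eq poly_query_or poly_query_imp poly_query_iff
  poly_query_all

section \<open>The query for equality\<close>

text \<open>
  Variable 1 is the vertex to be covered, variables 2 and 3 are the seed of the fixed point, and
  variable 4 is the vertex whose membership in the fixed point is defined.
\<close>

definition spread_q :: query where
  "spread_q = or_q (eq_q 4 2) (or_q (eq_q 4 3) (ex_q 5 (ex_q 6 (ex_q 7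
     (and_q (mark_q 5) (and_q (mark_q 6) (and_q (edge_q 5 6) (and_q (edge_q 5 7)
       (and_q (neq_q 7 6) (edge_q 7 4))))))))))"

text \<open>Here and in the following queries the fixed point is complete and its element variable
  is out of scope, so bound variables start at 4 again.\<close>

definition covered_q :: query where
  "covered_q = or_q (mark_q 1) (ex_q 4 (and_q (mark_q 4) (edge_q 4 1)))"

definition partner_q :: query where
  "partner_q = all_q 4 (imp_q (mark_q 4) (ex_q 5 (and_q (mark_q 5) (and_q (edge_q 4 5)
     (all_q 6 (imp_q (mark_q 6) (imp_q (edge_q 4 6) (eq_q 6 5))))))))"

definition independent_q :: query where
  "independent_q = all_q 4 (imp_q (not_q (mark_q 4)) (all_q 5 (imp_q (mark_q 5)
     (imp_q (edge_q 5 4) (all_q 6 (imp_q (edge_q 4 6) (mark_q 6)))))))"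

text \<open>Variables 4 to 10 stand for \<open>w\<close>, \<open>a\<close>, \<open>b\<close>,
  \<open>a'\<close>, \<open>b'\<close>, \<open>w'\<close>, \<open>z\<close> in the last condition of
  \<open>paired\<close>.\<close>

definition common_neighbour_q :: query where
  "common_neighbour_q = all_q 4 (imp_q (not_q (mark_q 4))
     (all_q 5 (imp_q (mark_q 5) (all_q 6 (imp_q (mark_q 6)
     (all_q 7 (imp_q (mark_q 7) (all_q 8 (imp_q (mark_q 8)
       (imp_q (and_q (neq_q 5 6) (and_q (edge_q 4 5) (and_q (edge_q 4 6)
           (and_q (edge_q 5 7) (edge_q 6 8)))))
         (ex_q 9 (all_q 10 (iff_q (edge_q 9 10) (or_q (eq_q 10 7) (eq_q 10 8)))))))))))))))"

definition check_q :: query where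
  "check_q = and_q partner_q (and_q independent_q (and_q common_neighbour_q covered_q))"

lemma spread_q_iff: "{x. x < n \<and> spread_q n E (r(4 := x)) X} = spread {..<n} E (r 2) (r 3) X"
  unfolding spread_q_def spread_def query_simps
  by (rule Collect_cong, simp, blast)

text \<open>The marks occur only positively in \<open>spread_q\<close>.\<close>

lemma spread_q_mono: "X \<subseteq> Y \<Longrightarrow> spread_q n E r X \<Longrightarrow> spread_q n E r Y"
  unfolding spread_q_def query_simps by simp blast

text \<open>The inclusion supplies the first condition of \<open>paired\<close>, which
  \<open>check_q\<close> does not test. For the fixed point it is
  \<open>lfp_spread_subset\<close>.\<close>

lemma check_q_iff:
  assumes "D \<subseteq> {..<n}"
  shows "check_q n E r D \<longleftrightarrow> paired {..<n} E D \<and> r 1 \<in> covered E D"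
proof -
  have all: "(\<forall>x<n. x \<in> D \<longrightarrow> Q x) \<longleftrightarrow> (\<forall>x\<in>D. Q x)"
    and ex: "(\<exists>x<n. x \<in> D \<and> Q x) \<longleftrightarrow> (\<exists>x\<in>D. Q x)"
    and ranges: "(\<forall>x\<in>{..<n} - D. Q x) \<longleftrightarrow> (\<forall>x<n. x \<notin> D \<longrightarrow> Q x)"
      "(\<forall>x\<in>{..<n}. Q x) \<longleftrightarrow> (\<forall>x<n. Q x)" "(\<exists>x\<in>{..<n}. Q x) \<longleftrightarrow> (\<exists>x<n. Q x)" for Q
    using assms by auto
  have "partner_q n E r D \<longleftrightarrow> (\<forall>a\<in>D. \<exists>b\<in>D. {a, b} \<in> E \<and> (\<forall>c\<in>D. {a, c} \<in> E \<longrightarrow> c = b))"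
    unfolding partner_q_def query_simps by (simp add: all ex)
  moreover have "independent_q n E r D \<longleftrightarrow> (\<forall>w\<in>{..<n} - D. \<forall>a\<in>D. {a, w} \<in> E \<longrightarrow>
      (\<forall>b\<in>{..<n}. {w, b} \<in> E \<longrightarrow> b \<in> D))"
    unfolding independent_q_def query_simps by (simp add: all ex ranges)
  moreover have "common_neighbour_q n E r D \<longleftrightarrow>
      (\<forall>w\<in>{..<n} - D. \<forall>a\<in>D. \<forall>b\<in>D. \<forall>a'\<in>D. \<forall>b'\<in>D.
          a \<noteq> b \<and> {w, a} \<in> E \<and> {w, b} \<in> E \<and> {a, a'} \<in> E \<and> {b, b'} \<in> E \<longrightarrow>
          (\<exists>w'\<in>{..<n}. \<forall>z\<in>{..<n}. {w', z} \<in> E \<longleftrightarrow> z = a' \<or> z = b'))"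
    unfolding common_neighbour_q_def query_simps by (simp add: all ex ranges)
  moreover have "covered_q n E r D \<longleftrightarrow> r 1 \<in> covered E D"
    unfolding covered_q_def query_simps covered_def by (simp add: all ex)
  ultimately show ?thesis
    using assms unfolding check_q_def and_q_def paired_def by simp
qed

lemma poly_query_spread: "poly_query True 5 spread_q"
  unfolding spread_q_def by (simp add: poly_query_intros)

lemma poly_query_check: "poly_query True 4 check_q"
proof -
  have "poly_query True 4 partner_q"
    unfolding partner_q_def by (simp add: poly_query_intros)
  moreover have "poly_query True 4 independent_q"
    unfolding independent_q_def by (simp add: poly_query_intros)
  moreover have "poly_query True 4 common_neighbour_q"
    unfolding common_neighbour_q_def by (simp add: poly_query_intros)
  moreover have "poly_query True 4 covered_q"
    unfolding covered_q_def by (simp add: poly_query_intros)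
  ultimately show ?thesis
    unfolding check_q_def by (simp add: poly_query_intros)
qed

theorem mainTheorem5:
  "poly_time_decidable
     (\<lambda>V E. min_degree V E = 2)
     (\<lambda>V E. total_domination_number V E = 2 * min_maximal_matching_number E)"
proof (rule poly_time_decidable_if_poly_query)
  have "poly_query False 4 (lfp_q 4 spread_q check_q)"
    using poly_query_spread poly_query_check spread_q_mono by (intro poly_query_lfp) simp_all
  then show "poly_query False 1 (all_q 1 (ex_q 2 (ex_q 3 (lfp_q 4 spread_q check_q))))"
    by (simp add: poly_query_intros numeral_eq_Suc)
next
  fix n :: nat and E r L
  assume "simple_graph {..<n} E" "min_degree {..<n} E = 2"
  then show "all_q 1 (ex_q 2 (ex_q 3 (lfp_q 4 spread_q check_q))) n E r L \<longleftrightarrow>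
      total_domination_number {..<n} E = 2 * min_maximal_matching_number E"
    by (simp add: equality_iff_spread lfp_q_def spread_q_iff check_q_iff lfp_spread_subset
        all_q_def ex_q_def Ball_def Bex_def)
qed

end
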